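(* Let $D(n)$ be the number of $3$-wise bipartite balanced designs on a fixed $n$-element set. Then $\ln D(n)=\Theta(n^3\ln n)$ as $n\to\infty$ through even values of $n$.
   Context: A $3$-wise bipartite balanced design $3$-BBD$(n)$ is a triple $(X,\{g_1,g_2\},B)$ where $|X|=n$, $\{g_1,g_2\}$ is a partition of $X$ with $|g_1|=|g_2|$, and $B$ is a set of $4$-element subsets of $X$ (blocks) with $|b\cap g_1|=|b\cap g_2|=2$ for every $b\in B$, such that every $3$-element subset $s\subseteq X$ meeting both $g_1$ and $g_2$ is contained in exactly one block. Notation $f=\Theta(g)$ means $c_1 g\le f\le c_2 g$ for some constants $0<c_1\le c_2$ and all sufficiently large arguments.
   Formalization: The limit is taken through multiples of 4 instead of all even n: for n ≡ 2 (mod 4), n ≥ 6, the blocks through a pair in one half would split the other half, of odd size n/2, into pairs, so D(n) = 0 and ln D(n) is undefined. *)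

theory Defs
  imports Complex_Main
begin

definition bbd3 :: "'a set \<Rightarrow> 'a set set \<Rightarrow> 'a set set \<Rightarrow> bool" where
  "bbd3 X P B \<longleftrightarrow>
     (\<exists>g1 g2. P = {g1, g2} \<and> g1 \<inter> g2 = {} \<and> g1 \<union> g2 = X \<and> card g1 = card g2 \<and>
        (\<forall>b\<in>B. b \<subseteq> X \<and> card b = 4 \<and> card (b \<inter> g1) = 2 \<and> card (b \<inter> g2) = 2) \<and>
        (\<forall>s. s \<subseteq> X \<and> card s = 3 \<and> s \<inter> g1 \<noteq> {} \<and> s \<inter> g2 \<noteq> {} \<longrightarrow>
             (\<exists>!b. b \<in> B \<and> s \<subseteq> b)))"

definition D :: "nat \<Rightarrow> nat" where
  "D n = card {(P, B). bbd3 {0..<n} P B}"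

end

theory Submission
  imports Defs "HOL-Library.FuncSet"
begin

text \<open>
Upper bound: any three points of a block determine the fourth, so a design is encoded by one half of
the point set together with a map from triples of points to points.

Lower bound: let the two halves have \<open>m\<close> points each. A 1-factorization of the complete graph on
\<open>m\<close> points yields a base design, whose blocks are the unions of an edge in each half, both of the
same colour. If the 1-factorization contains the group table of \<open>(Z/2)^k\<close> with \<open>2^k\<close>
proportional to \<open>m\<close>, the base design contains \<open>\<Theta>(m^4)\<close> trades (sets of 8 blocks that can be
replaced by 8 others covering the same triples), and each of them shares blocks with only \<open>O(m)\<close>
others. Choosing pairwise disjoint trades one after another therefore gives at least
\<open>(c m)^(c' m^3)\<close> families of disjoint trades, and distinct families lead to distinct designs.

The 1-factorization lives on \<open>(Z/2)^k\<close> together with \<open>Z/N\<close>. One colour for every element of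
\<open>Z/N\<close> comes from the translates of a starter, a partial matching of \<open>Z/N\<close> whose differences are
distinct and include all even ones except \<open>N/2\<close>; its unmatched points are joined to
\<open>(Z/2)^k\<close>. A leftover difference \<open>\<delta>\<close> gives a perfect matching of \<open>Z/N\<close> by sending every even \<open>x\<close> to
\<open>x + \<delta>\<close> and every odd \<open>x\<close> to \<open>x - \<delta>\<close>; these matchings share their colours with the nonzero
elements of \<open>(Z/2)^k\<close>.
\<close>

unbundle bit_operations_syntax

section \<open>XOR on natural numbers below a power of two\<close>

lemma xor_less_power2:
  fixes x y :: nat
  assumes "x < 2 ^ t" "y < 2 ^ t"
  shows "x XOR y < 2 ^ t"
  using assms by (metis take_bit_nat_eq_self_iff take_bit_xor)

lemma xor_cancel_left [simp]: "x XOR (x XOR y) = (y :: nat)"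
  by (simp flip: xor.assoc)

lemma xor_cancel_right [simp]: "(x XOR y) XOR y = (x :: nat)"
  by (simp add: xor.assoc)

lemma xor_left_inj [simp]: "x XOR y = x XOR z \<longleftrightarrow> y = (z :: nat)"
  by (metis xor_cancel_left)

lemma xor_eq_0_iff_nat [simp]: "x XOR y = 0 \<longleftrightarrow> x = (y :: nat)"
  by (metis xor_left_inj xor_self_eq)

text \<open>If \<open>d XOR x\<close> were below \<open>2 ^ t\<close>, then so would be
  \<open>(d XOR x) XOR x = d\<close>.\<close>

lemma xor_high_bit:
  fixes x d :: nat
  assumes "x < 2 ^ t" "2 ^ t \<le> d" "d < 2 ^ Suc t"
  shows "2 ^ t \<le> d XOR x" "d XOR x < 2 ^ Suc t"
proof -
  show "2 ^ t \<le> d XOR x"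
    using assms xor_less_power2[of "d XOR x" t x] by (cases "d XOR x < 2 ^ t") auto
  show "d XOR x < 2 ^ Suc t"
    using assms by (intro xor_less_power2) auto
qed

section \<open>One-factorizations\<close>

text \<open>The colour classes are perfect matchings of the complete graph on \<open>V\<close>;
  diagonal values \<open>col x x\<close> stay unconstrained.\<close>

definition one_factorization :: "'v set \<Rightarrow> 'c set \<Rightarrow> ('v \<Rightarrow> 'v \<Rightarrow> 'c) \<Rightarrow> bool" where
  "one_factorization V C col \<longleftrightarrow>
     (\<forall>x\<in>V. \<forall>y\<in>V. col x y = col y x) \<and> (\<forall>x\<in>V. bij_betw (col x) (V - {x}) C)"

lemma one_factorization_sym:
  "one_factorization V C col \<Longrightarrow> x \<in> V \<Longrightarrow> y \<in> V \<Longrightarrow> col x y = col y x"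
  by (auto simp: one_factorization_def)

lemma one_factorization_in:
  "one_factorization V C col \<Longrightarrow> x \<in> V \<Longrightarrow> y \<in> V \<Longrightarrow> x \<noteq> y \<Longrightarrow> col x y \<in> C"
  by (auto simp: one_factorization_def bij_betw_def)

lemma one_factorization_inj:
  "one_factorization V C col \<Longrightarrow> x \<in> V \<Longrightarrow> y \<in> V \<Longrightarrow> z \<in> V \<Longrightarrow> x \<noteq> y \<Longrightarrow> x \<noteq> z \<Longrightarrow>
    col x y = col x z \<Longrightarrow> y = z"
  unfolding one_factorization_def bij_betw_def inj_on_def by blast

lemma one_factorization_obtain:
  assumes "one_factorization V C col" "x \<in> V" "s \<in> C"
  obtains y where "y \<in> V" "y \<noteq> x" "col x y = s"
proof -
  have "s \<in> col x ` (V - {x})"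
    using assms unfolding one_factorization_def bij_betw_def by blast
  then show ?thesis using that by auto
qed

lemma one_factorization_transport:
  assumes F: "one_factorization V C col" and h: "bij_betw h W V"
  shows "one_factorization W C (\<lambda>x y. col (h x) (h y))"
proof -
  have "bij_betw (\<lambda>y. col (h x) (h y)) (W - {x}) C" if "x \<in> W" for x
  proof -
    have hx: "h x \<in> V" using h that by (auto simp: bij_betw_def)
    have "bij_betw h (W - {x}) (V - {h x})"
      using h that unfolding bij_betw_def by (auto simp: inj_on_def)
    moreover have "bij_betw (col (h x)) (V - {h x}) C"
      using F hx by (auto simp: one_factorization_def)
    ultimately show ?thesis
      using bij_betw_trans by (fastforce simp: comp_def)
  qed
  moreover have "col (h x) (h y) = col (h y) (h x)" if "x \<in> W" "y \<in> W" for x y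
    using that h F by (auto simp: bij_betw_def one_factorization_def)
  ultimately show ?thesis by (simp add: one_factorization_def)
qed

section \<open>One-factorizations from starters\<close>

text \<open>\<open>E\<close> is the set of differences of the starter, which matches \<open>g \<delta>\<close> with \<open>g \<delta> + \<delta>\<close>; \<open>\<phi>\<close>
enumerates its unmatched points, and \<open>\<beta>\<close> assigns colours to the leftover differences.\<close>

fun starter_col ::
  "int \<Rightarrow> int set \<Rightarrow> (int \<Rightarrow> int) \<Rightarrow> (nat \<Rightarrow> int) \<Rightarrow> (int \<Rightarrow> nat) \<Rightarrow> nat + int \<Rightarrow> nat + int \<Rightarrow> nat + int" where
  "starter_col N E g \<phi> \<beta> (Inl x) (Inl y) = Inl (x XOR y)"
| "starter_col N E g \<phi> \<beta> (Inl x) (Inr y) = Inr ((y - \<phi> x) mod N)"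
| "starter_col N E g \<phi> \<beta> (Inr x) (Inl y) = Inr ((x - \<phi> y) mod N)"
| "starter_col N E g \<phi> \<beta> (Inr x) (Inr y) =
     (let \<delta> = (y - x) mod N in
       if \<delta> \<in> E then Inr ((x - g \<delta>) mod N)
       else Inl (\<beta> (if even x then \<delta> else (- \<delta>) mod N)))"

lemma mod_diff_cancel:
  fixes N :: int
  assumes "(a - b) mod N = (a - c) mod N"
  shows "b mod N = c mod N"
proof -
  have "N dvd (a - b) - (a - c)" using assms by (simp add: mod_eq_dvd_iff)
  then have "N dvd c - b" by simp
  then show ?thesis by (metis mod_eq_dvd_iff)
qed

text \<open>An edge at \<open>x\<close> with translation colour \<open>s\<close> comes from the
  starter point \<open>x - s\<close>. This point is some \<open>g \<delta>\<close> or some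
  \<open>\<phi> y\<close>, never both, so such colours are distinct at \<open>x\<close>; colours of
  leftover differences are separated by \<open>\<beta>\<close>. Equal cardinalities then turn
  injectivity at each vertex into bijectivity.\<close>

lemma one_factorization_starter:
  fixes N :: int and E :: "int set" and g :: "int \<Rightarrow> int" and \<phi> :: "nat \<Rightarrow> int"
    and \<beta> :: "int \<Rightarrow> nat"
  assumes N: "N > 0" "even N" and E: "E \<subseteq> {1..<N}"
    and neg: "\<And>\<delta>. \<delta> \<in> E \<Longrightarrow> N - \<delta> \<in> E \<and> g (N - \<delta>) mod N = (g \<delta> + \<delta>) mod N"
    and inj: "inj_on (\<lambda>\<delta>. g \<delta> mod N) E"
    and evens: "\<And>\<delta>. \<delta> \<in> {1..<N} - E \<Longrightarrow> even \<delta> \<Longrightarrow> 2 * \<delta> = N"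
    and \<phi>: "bij_betw \<phi> {0..<2 ^ t} ({0..<N} - (\<lambda>\<delta>. g \<delta> mod N) ` E)"
    and \<beta>: "bij_betw \<beta> ({1..<N} - E) {1..<2 ^ t}"
  shows "one_factorization (Inl ` {0..<2 ^ t} \<union> Inr ` {0..<N})
           (Inl ` {1..<2 ^ t} \<union> Inr ` {0..<N}) (starter_col N E g \<phi> \<beta>)"
proof -
  let ?c = "starter_col N E g \<phi> \<beta>"
  let ?V = "Inl ` {0..<2 ^ t} \<union> Inr ` {0..<N} :: (nat + int) set"
  let ?C = "Inl ` {1..<2 ^ t} \<union> Inr ` {0..<N} :: (nat + int) set"
  have diff: "(y - x) mod N \<in> {1..<N}" if "x \<in> {0..<N}" "y \<in> {0..<N}" "x \<noteq> y" for x y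
  proof -
    have "(y - x) mod N \<noteq> 0"
    proof
      assume "(y - x) mod N = 0"
      then have "y mod N = x mod N" by (simp add: mod_eq_dvd_iff mod_eq_0_iff_dvd)
      with that show False by simp
    qed
    moreover have "0 \<le> (y - x) mod N" "(y - x) mod N < N" using N by auto
    ultimately show ?thesis by simp
  qed
  have negmod: "(- \<delta>) mod N = N - \<delta>" if "\<delta> \<in> {1..<N}" for \<delta>
    using that by (simp add: zmod_zminus1_eq_if)
  have negE: "N - \<delta> \<in> E \<longleftrightarrow> \<delta> \<in> E" for \<delta>
    using neg[of \<delta>] neg[of "N - \<delta>"] by auto
  have negmem: "N - \<delta> \<in> {1..<N} - E" if "\<delta> \<in> {1..<N} - E" for \<delta>
    using that negE by auto
  have flip: "(x - y) mod N = N - (y - x) mod N"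
    if "x \<in> {0..<N}" "y \<in> {0..<N}" "x \<noteq> y" for x y
  proof -
    have "(x - y) mod N = (- (y - x)) mod N" by simp
    also have "\<dots> = (- ((y - x) mod N)) mod N" by (simp add: mod_minus_eq)
    also have "\<dots> = N - (y - x) mod N" using negmod[OF diff[OF that]] .
    finally show ?thesis .
  qed
  have par: "even ((y - x) mod N) \<longleftrightarrow> (even x \<longleftrightarrow> even y)" for x y
    using N(2) by (auto simp: dvd_mod_iff)
  have \<phi>in: "\<phi> x \<in> {0..<N}" "\<phi> x \<notin> (\<lambda>\<delta>. g \<delta> mod N) ` E" if "x < 2 ^ t" for x
    using bij_betwE[OF \<phi>] that by auto
  have \<phi>inj: "x = y" if "\<phi> x = \<phi> y" "x < 2 ^ t" "y < 2 ^ t" for x y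
    using \<phi> that by (auto simp: bij_betw_def inj_on_def)
  have \<beta>in: "1 \<le> \<beta> \<delta>" "\<beta> \<delta> < 2 ^ t" if "\<delta> \<in> {1..<N} - E" for \<delta>
    using bij_betwE[OF \<beta>] that by auto
  have \<beta>inj: "x = y" if "\<beta> x = \<beta> y" "x \<in> {1..<N} - E" "y \<in> {1..<N} - E" for x y
    using \<beta> that unfolding bij_betw_def inj_on_def by blast
  have sym_r: "?c (Inr x) (Inr y) = ?c (Inr y) (Inr x)" if "x \<in> {0..<N}" "y \<in> {0..<N}" "x \<noteq> y" for x y
  proof -
    define \<delta> where "\<delta> = (y - x) mod N"
    have d: "\<delta> \<in> {1..<N}" using diff[OF that] by (simp add: \<delta>_def)
    have d': "(x - y) mod N = N - \<delta>" using flip[OF that] by (simp add: \<delta>_def)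
    show ?thesis
    proof (cases "\<delta> \<in> E")
      case True
      have "(y - g (N - \<delta>)) mod N = (y - g (N - \<delta>) mod N) mod N" by (simp add: mod_diff_right_eq)
      also have "\<dots> = (y - (g \<delta> + \<delta>)) mod N" using neg[OF True] by (simp add: mod_diff_right_eq)
      also have "\<dots> = ((y - g \<delta>) - \<delta>) mod N" by (simp add: algebra_simps)
      also have "\<dots> = ((y - g \<delta>) - (y - x)) mod N" unfolding \<delta>_def by (simp add: mod_diff_right_eq)
      finally have "(y - g (N - \<delta>)) mod N = (x - g \<delta>) mod N" by simp
      then show ?thesis using True d' by (simp add: Let_def negE flip: \<delta>_def)
    next
      case False
      \<comment> \<open>An even leftover difference is \<open>N / 2\<close>, its own negative; an
        odd one joins points of opposite parity. Either way both ends pass the same residue to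
        \<open>\<beta>\<close>.\<close>
      have eq: "N - \<delta> = \<delta>" if "even \<delta>" using evens[of \<delta>] d False that by auto
      have "even x \<longleftrightarrow> even y" if "even \<delta>" using par[of y x] that by (simp add: \<delta>_def)
      moreover have "even x \<longleftrightarrow> odd y" if "odd \<delta>" using par[of y x] that by (auto simp: \<delta>_def)
      ultimately have "(if even x then \<delta> else N - \<delta>) = (if even y then N - \<delta> else \<delta>)"
        using eq by (cases "even \<delta>") auto
      moreover have "?c (Inr x) (Inr y) = Inl (\<beta> (if even x then \<delta> else N - \<delta>))"
        using False negmod[OF d] by (simp add: Let_def flip: \<delta>_def)
      moreover have "?c (Inr y) (Inr x) = Inl (\<beta> (if even y then N - \<delta> else \<delta>))"
      proof -
        have "(- (N - \<delta>)) mod N = \<delta>" using negmod[of "N - \<delta>"] d by simp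
        then show ?thesis using False d' negE by (simp add: Let_def)
      qed
      ultimately show ?thesis by simp
    qed
  qed
  have sym: "?c v w = ?c w v" if "v \<in> ?V" "w \<in> ?V" for v w
  proof (cases v; cases w)
    fix x y assume "v = Inr x" "w = Inr y"
    then show ?thesis using that sym_r[of x y] by (cases "x = y") auto
  qed (use that in \<open>auto simp: xor.commute\<close>)
  have into: "?c v w \<in> ?C" if "v \<in> ?V" "w \<in> ?V" "w \<noteq> v" for v w
  proof (cases v; cases w)
    fix x y assume vw: "v = Inl x" "w = Inl y"
    then have "x XOR y \<noteq> 0" and lt: "x XOR y < 2 ^ t" using that by (auto intro: xor_less_power2)
    then have "1 \<le> x XOR y" by linarith
    then show ?thesis using vw lt by auto
  next
    fix x y assume vw: "v = Inr x" "w = Inr y"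
    then have d: "(y - x) mod N \<in> {1..<N}" using diff[of x y] that by auto
    show ?thesis
    proof (cases "(y - x) mod N \<in> E")
      case True
      then show ?thesis using vw N by (auto simp: Let_def)
    next
      case False
      then have "(y - x) mod N \<in> {1..<N} - E" "(- ((y - x) mod N)) mod N \<in> {1..<N} - E"
        using negmod[OF d] negmem d by auto
      then show ?thesis using vw False \<beta>in by (auto simp: Let_def image_iff simp del: mod_minus_eq)
    qed
  qed (use that N in \<open>auto\<close>)
  have injc: "w = w'" if H: "v \<in> ?V" "w \<in> ?V" "w' \<in> ?V" "w \<noteq> v" "w' \<noteq> v" "?c v w = ?c v w'" for v w w'
  proof (cases v)
    case (Inl x)
    have rr: "y = z" if "y \<in> {0..<N}" "z \<in> {0..<N}" "(y - \<phi> x) mod N = (z - \<phi> x) mod N" for y z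
    proof -
      have "y mod N = z mod N" using that(3) by (simp add: mod_eq_dvd_iff)
      then show ?thesis using that by simp
    qed
    consider y where "w = Inl y" | y where "w = Inr y" "y \<in> {0..<N}" using H(2) by blast
    then show ?thesis
    proof cases
      case w: 1
      then show ?thesis using H(6) Inl by (cases w') auto
    next
      case w: 2
      then obtain z where "w' = Inr z" "z \<in> {0..<N}" using H(3,6) Inl by auto
      then show ?thesis using w H(6) Inl rr[of y z] by simp
    qed
  next
    case (Inr x)
    have x: "x \<in> {0..<N}" using H Inr by auto
    \<comment> \<open>A common colour would identify the unmatched point \<open>\<phi> y\<close>
      with a matched point \<open>g \<delta>\<close>.\<close>
    have mixed: False if "y \<in> {0..<2 ^ t}" "z \<in> {0..<N}" "z \<noteq> x" "?c v (Inl y) = ?c v (Inr z)" for y z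
    proof -
      have E': "(z - x) mod N \<in> E" and "(x - \<phi> y) mod N = (x - g ((z - x) mod N)) mod N"
        using that Inr by (auto simp: Let_def split: if_splits)
      then have "\<phi> y mod N = g ((z - x) mod N) mod N" by (blast intro: mod_diff_cancel)
      then show False using \<phi>in[of y] that(1) E' by auto
    qed
    have ll: "y = z" if "y \<in> {0..<2 ^ t}" "z \<in> {0..<2 ^ t}" "?c v (Inl y) = ?c v (Inl z)" for y z
    proof -
      have "\<phi> y mod N = \<phi> z mod N" using that Inr by (auto intro: mod_diff_cancel)
      then show ?thesis using \<phi>in that \<phi>inj by auto
    qed
    have rr: "y = z" if yz: "y \<in> {0..<N}" "z \<in> {0..<N}" "y \<noteq> x" "z \<noteq> x" "?c v (Inr y) = ?c v (Inr z)" for y z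
    proof -
      have d: "(y - x) mod N \<in> {1..<N}" "(z - x) mod N \<in> {1..<N}" using diff x yz by auto
      have "(y - x) mod N = (z - x) mod N"
      proof (cases "(y - x) mod N \<in> E")
        case True
        then have E': "(z - x) mod N \<in> E" and
           "(x - g ((y - x) mod N)) mod N = (x - g ((z - x) mod N)) mod N"
          using yz Inr by (auto simp: Let_def split: if_splits)
        then have "g ((y - x) mod N) mod N = g ((z - x) mod N) mod N" by (blast intro: mod_diff_cancel)
        then show ?thesis using inj True E' by (auto simp: inj_on_def)
      next
        case False
        then have F': "(z - x) mod N \<notin> E" using yz Inr by (auto simp: Let_def split: if_splits)
        have mem: "N - (y - x) mod N \<in> {1..<N} - E" "N - (z - x) mod N \<in> {1..<N} - E"
          using negmem[of "(y - x) mod N"] negmem[of "(z - x) mod N"] d False F' by blast+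
        show ?thesis
        proof (cases "even x")
          case True
          then show ?thesis using yz Inr False F' d by (auto simp: Let_def intro!: \<beta>inj)
        next
          case odd: False
          then have "\<beta> ((- ((y - x) mod N)) mod N) = \<beta> ((- ((z - x) mod N)) mod N)"
            using yz Inr False F' by (simp add: Let_def)
          then have "\<beta> (N - (y - x) mod N) = \<beta> (N - (z - x) mod N)" using negmod d by simp
          from \<beta>inj[OF this mem] show ?thesis by simp
        qed
      qed
      then have "((y - x) mod N + x) mod N = ((z - x) mod N + x) mod N" by simp
      then show ?thesis using yz by (simp add: mod_add_left_eq)
    qed
    consider y where "w = Inl y" "y \<in> {0..<2 ^ t}" | y where "w = Inr y" "y \<in> {0..<N}" "y \<noteq> x"
      using H(2,4) Inr by blast
    then show ?thesis
    proof cases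
      case w: 1
      consider z where "w' = Inl z" "z \<in> {0..<2 ^ t}" | z where "w' = Inr z" "z \<in> {0..<N}" "z \<noteq> x"
        using H(3,5) Inr by blast
      then show ?thesis
        by cases (use H(6) w ll mixed in blast)+
    next
      case w: 2
      consider z where "w' = Inl z" "z \<in> {0..<2 ^ t}" | z where "w' = Inr z" "z \<in> {0..<N}" "z \<noteq> x"
        using H(3,5) Inr by blast
      then show ?thesis
      proof cases
        case 1
        then show ?thesis using H(6) w mixed[of z y] by simp
      next
        case 2
        then show ?thesis using H(6) w rr[of y z] by simp
      qed
    qed
  qed
  have "bij_betw (?c v) (?V - {v}) ?C" if v: "v \<in> ?V" for v
  proof -
    have inj': "inj_on (?c v) (?V - {v})" using injc v by (intro inj_onI) blast
    have sub: "?c v ` (?V - {v}) \<subseteq> ?C" using into v by blast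
    have "card ?V = 2 ^ t + nat N"
      by (subst card_Un_disjoint) (auto simp: card_image inj_on_def)
    then have "card (?V - {v}) = 2 ^ t + nat N - 1"
      using v by (subst card_Diff_singleton) auto
    moreover have "card ?C = 2 ^ t - 1 + nat N"
      by (subst card_Un_disjoint) (auto simp: card_image inj_on_def)
    \<comment> \<open>The deleted vertex balances the element 0 of \<open>(Z/2)^t\<close>, which is
      not a colour.\<close>
    ultimately have "card (?V - {v}) = card ?C"
      by (simp add: Nat.add_diff_assoc2)
    then have "?c v ` (?V - {v}) = ?C"
      using inj' sub by (intro card_subset_eq) (auto simp: card_image)
    with inj' show ?thesis by (simp add: bij_betw_def)
  qed
  then show ?thesis using sym by (simp add: one_factorization_def)
qed

text \<open>One count yields both bijections: \<open>N - card E = 2 ^ t\<close> points are unmatched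
  and \<open>N - 1 - card E = 2 ^ t - 1\<close> nonzero differences are left over. Renumbering then
  makes \<open>(Z/2)^t\<close> the initial segment of the vertices.\<close>

lemma one_factorization_starter_existence:
  fixes N :: int and E :: "int set" and g :: "int \<Rightarrow> int"
  assumes N: "N > 0" "even N" and E: "E \<subseteq> {1..<N}"
    and neg: "\<And>\<delta>. \<delta> \<in> E \<Longrightarrow> N - \<delta> \<in> E \<and> g (N - \<delta>) mod N = (g \<delta> + \<delta>) mod N"
    and inj: "inj_on (\<lambda>\<delta>. g \<delta> mod N) E"
    and evens: "\<And>\<delta>. \<delta> \<in> {1..<N} - E \<Longrightarrow> even \<delta> \<Longrightarrow> 2 * \<delta> = N"
    and card: "card E + 2 ^ t = nat N"
  shows "\<exists>C (col :: nat \<Rightarrow> nat \<Rightarrow> nat + int). one_factorization {0..<2 ^ t + nat N} C col \<and>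
           (\<forall>x<2 ^ t. \<forall>y<2 ^ t. col x y = Inl (x XOR y))"
proof -
  have finE: "finite E" using E by (rule finite_subset) simp
  have "card ({0..<N} - (\<lambda>\<delta>. g \<delta> mod N) ` E) = nat N - card E"
    using N inj finE by (subst card_Diff_subset) (auto simp: card_image)
  also have "\<dots> = card {0..<2 ^ t :: nat}" using card by simp
  finally obtain \<phi> where \<phi>: "bij_betw \<phi> {0..<2 ^ t :: nat} ({0..<N} - (\<lambda>\<delta>. g \<delta> mod N) ` E)"
    using finite_same_card_bij[of "{0..<2 ^ t :: nat}" "{0..<N} - (\<lambda>\<delta>. g \<delta> mod N) ` E"] by auto
  have "card ({1..<N} - E) = nat (N - 1) - card E"
    using E finE by (subst card_Diff_subset) auto
  also have "\<dots> = card {1..<2 ^ t :: nat}" using card by simp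
  finally obtain \<beta> where \<beta>: "bij_betw \<beta> ({1..<N} - E) {1..<2 ^ t :: nat}"
    using finite_same_card_bij[of "{1..<N} - E" "{1..<2 ^ t :: nat}"] by auto
  define h :: "nat \<Rightarrow> nat + int" where
    "h x = (if x < 2 ^ t then Inl x else Inr (int (x - 2 ^ t)))" for x
  have "bij_betw h {0..<2 ^ t + nat N} (Inl ` {0..<2 ^ t} \<union> Inr ` {0..<N})"
  proof (rule bij_betw_byWitness[where f' = "\<lambda>v. case v of Inl x \<Rightarrow> x | Inr y \<Rightarrow> 2 ^ t + nat y"])
  qed (auto simp: h_def not_less image_iff dest!: le_Suc_ex split: if_splits)
  from one_factorization_transport[OF one_factorization_starter[OF N E neg inj evens \<phi> \<beta>] this]
  have "one_factorization {0..<2 ^ t + nat N} (Inl ` {1..<2 ^ t} \<union> Inr ` {0..<N})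
          (\<lambda>x y. starter_col N E g \<phi> \<beta> (h x) (h y))" by blast
  moreover have "\<forall>x<2 ^ t. \<forall>y<2 ^ t. starter_col N E g \<phi> \<beta> (h x) (h y) = Inl (x XOR y)"
    by (simp add: h_def)
  ultimately show ?thesis by (intro exI conjI)
qed

section \<open>A concrete starter\<close>

text \<open>Here \<open>N = 2 * h\<close>. Residues are represented in \<open>{0..<N}\<close>; in terms of the representative with
\<open>\<bar>\<delta>\<bar> < h\<close> the starter consists of the pairs \<open>{-i, i}\<close> for the even differences and
\<open>{h - i, h + 1 + i}\<close>, \<open>i < p\<close>, for the odd ones.\<close>

definition starter_set :: "int \<Rightarrow> nat \<Rightarrow> int set" where
  "starter_set h p = {\<delta> \<in> {1..<2 * h}. if even \<delta> then \<delta> \<noteq> h else \<delta> < 2 * int p \<or> 2 * h - 2 * int p < \<delta>}"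

text \<open>For \<open>\<delta> > h\<close> the value is the other end of the pair belonging to
  \<open>2 * h - \<delta>\<close>, so each pair is listed under both signs of its
  difference.\<close>

definition starter_point :: "int \<Rightarrow> int \<Rightarrow> int" where
  "starter_point h \<delta> = (if even \<delta> then if \<delta> < h then - (\<delta> div 2) else h - \<delta> div 2
     else if \<delta> < h then h + (1 - \<delta>) div 2 else 2 * h + (1 - \<delta>) div 2)"

text \<open>There are \<open>h - 1\<close> nonzero even residues, and \<open>h\<close> is dropped if
  it is one of them; each induction step adds the odd residue \<open>2 * p + 1\<close> and its
  negative.\<close>

lemma card_starter_set:
  assumes h: "h > 0" and p: "2 * int p \<le> h"
  shows "int (card (starter_set h p)) = h - 1 - (if even h then 1 else 0) + 2 * int p"
  using p
proof (induction p)
  case 0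
  have eq: "starter_set h 0 = (\<lambda>i. 2 * i) ` {1..<h} - {h}"
    by (auto simp: starter_set_def elim!: evenE)
  have card: "card ((\<lambda>i. 2 * i) ` {1..<h} :: int set) = nat (h - 1)"
    by (subst card_image) (auto simp: inj_on_def)
  have mem: "h \<in> (\<lambda>i. 2 * i) ` {1..<h} \<longleftrightarrow> even h"
    using h by (auto elim!: evenE)
  show ?case
  proof (cases "even h")
    case True
    then have "h \<ge> 2" using h by presburger
    then show ?thesis unfolding eq using True mem card by (simp add: card_Diff_singleton)
  next
    case False
    then show ?thesis unfolding eq using mem card h by simp
  qed
next
  case (Suc p)
  have "\<delta> \<in> starter_set h (Suc p) \<longleftrightarrow>
    \<delta> \<in> insert (2 * int p + 1) (insert (2 * h - (2 * int p + 1)) (starter_set h p))" for \<delta>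
  proof (cases "even \<delta>")
    case True
    then have "\<delta> \<noteq> 2 * int p + 1" "\<delta> \<noteq> 2 * h - (2 * int p + 1)" by presburger+
    then show ?thesis using True by (simp add: starter_set_def)
  next
    case False
    then obtain b where "\<delta> = 2 * b + 1" by (elim oddE)
    then show ?thesis using Suc.prems h by (auto simp: starter_set_def; arith)
  qed
  then have "starter_set h (Suc p) = insert (2 * int p + 1) (insert (2 * h - (2 * int p + 1)) (starter_set h p))"
    by blast
  moreover have "2 * h - (2 * int p + 1) \<notin> starter_set h p" "2 * int p + 1 \<notin> starter_set h p"
    using Suc.prems by (auto simp: starter_set_def)
  moreover have "2 * int p + 1 \<noteq> 2 * h - (2 * int p + 1)"
    using Suc.prems by simp
  moreover have "finite (starter_set h p)"
    by (rule finite_subset[of _ "{1..<2 * h}"]) (auto simp: starter_set_def)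
  ultimately show ?case using Suc by simp
qed

lemma starter_set_neg:
  assumes "2 * int p \<le> h" "\<delta> \<in> starter_set h p"
  shows "2 * h - \<delta> \<in> starter_set h p"
    and "starter_point h (2 * h - \<delta>) mod (2 * h) = (starter_point h \<delta> + \<delta>) mod (2 * h)"
proof -
  show "2 * h - \<delta> \<in> starter_set h p"
    using assms by (auto simp: starter_set_def)
  have "starter_point h (2 * h - \<delta>) - (starter_point h \<delta> + \<delta>) \<in> {- (2 * h), 0, 2 * h}"
    using assms by (auto simp: starter_set_def starter_point_def elim!: evenE oddE split: if_splits)
  then show "starter_point h (2 * h - \<delta>) mod (2 * h) = (starter_point h \<delta> + \<delta>) mod (2 * h)"
    by (auto simp: mod_eq_dvd_iff)
qed

lemma inj_on_starter_point:
  assumes p: "2 * int p \<le> h"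
  shows "inj_on (\<lambda>\<delta>. starter_point h \<delta> mod (2 * h)) (starter_set h p)"
proof (rule inj_onI)
  fix \<delta> \<epsilon> assume *: "\<delta> \<in> starter_set h p" "\<epsilon> \<in> starter_set h p"
    "starter_point h \<delta> mod (2 * h) = starter_point h \<epsilon> mod (2 * h)"
  \<comment> \<open>All starter points lie in the window (-h/2, 3h/2] of length
    \<open>2 * h\<close>, so congruent points are equal.\<close>
  have range: "- h < 2 * starter_point h \<delta>" "2 * starter_point h \<delta> \<le> 3 * h" if "\<delta> \<in> starter_set h p" for \<delta>
    using that p by (auto simp: starter_set_def starter_point_def elim!: evenE oddE split: if_splits)
  have "2 * h dvd starter_point h \<delta> - starter_point h \<epsilon>" using *(3) by (simp add: mod_eq_dvd_iff)
  then have eq: "starter_point h \<delta> = starter_point h \<epsilon>"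
    using range[OF *(1)] range[OF *(2)] dvd_imp_le_int[of "starter_point h \<delta> - starter_point h \<epsilon>" "2 * h"]
    by linarith
  then show "\<delta> = \<epsilon>"
    using *(1,2) p by (auto simp: starter_set_def starter_point_def elim!: evenE oddE split: if_splits)
qed

lemma xor_one_factorization_exists:
  assumes t: "t \<ge> 1" and m: "3 * 2 ^ t \<le> m" "even m"
  shows "\<exists>C (col :: nat \<Rightarrow> nat \<Rightarrow> nat + int). one_factorization {0..<m} C col \<and>
           (\<forall>x<2 ^ t. \<forall>y<2 ^ t. col x y = Inl (x XOR y))"
proof -
  define r :: nat where "r = 2 ^ t"
  have r: "even r" "r \<ge> 2" using t by (auto simp: r_def self_le_power)
  define k where "k = (m - r) div 2"
  define h where "h = int k"
  have mk: "m = r + 2 * k" using m r by (auto simp: k_def r_def)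
  then have rk: "r \<le> k" using m by (simp add: r_def)
  \<comment> \<open>The solution of \<open>card (starter_set h p) + r = 2 * h\<close>. The division
    is exact because \<open>r\<close> is even; \<open>r \<le> k\<close> prevents truncation of the
    subtraction, and \<open>r \<ge> 2\<close> gives \<open>2 * p \<le> k\<close>.\<close>
  define p where "p = (k + (if even k then 2 else 1) - r) div 2"
  have p: "2 * p + r = k + (if even k then 2 else 1)"
    using rk r by (auto simp: p_def)
  have ph: "2 * int p \<le> h" and h: "h > 0" using p r rk by (auto simp: h_def split: if_splits)
  have "int (card (starter_set h p)) + int r = 2 * h"
    using card_starter_set[OF h ph] p rk by (auto simp: h_def split: if_splits)
  then have "card (starter_set h p) + r = nat (2 * h)" by linarith
  then have card: "card (starter_set h p) + 2 ^ t = nat (2 * h)" by (simp add: r_def)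
  have "2 ^ t + nat (2 * h) = m" using mk by (simp add: r_def h_def)
  moreover have "\<exists>C (col :: nat \<Rightarrow> nat \<Rightarrow> nat + int). one_factorization {0..<2 ^ t + nat (2 * h)} C col \<and>
           (\<forall>x<2 ^ t. \<forall>y<2 ^ t. col x y = Inl (x XOR y))"
    using h card starter_set_neg[OF ph] inj_on_starter_point[OF ph]
    by (intro one_factorization_starter_existence[where E = "starter_set h p" and g = "starter_point h"])
       (auto simp: starter_set_def split: if_splits)
  ultimately show ?thesis by simp
qed

section \<open>Counting families of disjoint trades\<close>

definition indep :: "'a set \<Rightarrow> ('a \<Rightarrow> 'a \<Rightarrow> bool) \<Rightarrow> nat \<Rightarrow> 'a set set" where
  "indep T R k = {S. S \<subseteq> T \<and> card S = k \<and> (\<forall>p\<in>S. \<forall>q\<in>S. p \<noteq> q \<longrightarrow> \<not> R p q)}"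

lemma finite_indep: "finite T \<Longrightarrow> finite (indep T R k)"
  by (rule finite_subset[of _ "Pow T"]) (auto simp: indep_def)

text \<open>Double counting of the ways to extend an independent set by one element.\<close>

lemma card_indep_Suc:
  assumes T: "finite T" and refl: "\<And>p. p \<in> T \<Longrightarrow> R p p" and sym: "\<And>p q. R p q \<Longrightarrow> R q p"
    and deg: "\<And>p. p \<in> T \<Longrightarrow> card {q \<in> T. R p q} \<le> \<Delta>"
    and L: "L + k * \<Delta> \<le> card T"
  shows "L * card (indep T R k) \<le> Suc k * card (indep T R (Suc k))"
proof -
  \<comment> \<open>The elements that can extend \<open>S\<close>: each member of \<open>S\<close>
    excludes at most \<open>\<Delta>\<close> elements, itself included, so at least \<open>L\<close>
    remain.\<close>
  define A where "A S = T - (\<Union>p\<in>S. {q \<in> T. R p q})" for S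
  have fin: "finite S" if "S \<in> indep T R j" for S j
    using that T by (auto simp: indep_def intro: finite_subset)
  have cardA: "L \<le> card (A S)" if S: "S \<in> indep T R k" for S
  proof -
    have "card (\<Union>p\<in>S. {q \<in> T. R p q}) \<le> (\<Sum>p\<in>S. card {q \<in> T. R p q})"
      using fin[OF S] by (rule card_UN_le)
    also have "\<dots> \<le> (\<Sum>p\<in>S. \<Delta>)" using S deg by (intro sum_mono) (auto simp: indep_def)
    also have "\<dots> = k * \<Delta>" using S by (simp add: indep_def)
    finally have "card (\<Union>p\<in>S. {q \<in> T. R p q}) \<le> k * \<Delta>" .
    moreover have "card T - card (\<Union>p\<in>S. {q \<in> T. R p q}) \<le> card (A S)"
      unfolding A_def using T by (intro diff_card_le_card_Diff) (auto intro: finite_subset)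
    ultimately show ?thesis using L by linarith
  qed
  have notin: "v \<notin> S" if "S \<in> indep T R k" "v \<in> A S" for S v
    using that refl by (auto simp: A_def indep_def)
  have "L * card (indep T R k) = (\<Sum>S\<in>indep T R k. L)" by simp
  also have "\<dots> \<le> (\<Sum>S\<in>indep T R k. card (A S))" using cardA by (intro sum_mono)
  also have "\<dots> = card (Sigma (indep T R k) A)"
    using T finite_indep[OF T] by (subst card_SigmaI) (auto simp: A_def)
  also have "\<dots> \<le> card (Sigma (indep T R (Suc k)) (\<lambda>S. S))"
  proof (rule card_inj_on_le)
    show "inj_on (\<lambda>(S, v). (insert v S, v)) (Sigma (indep T R k) A)"
    proof -
      have "S = S'" if "S \<in> indep T R k" "v \<in> A S" "S' \<in> indep T R k" "v \<in> A S'"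
        "insert v S = insert v S'" for S S' v
        using that notin by (metis insert_ident)
      then show ?thesis by (auto simp: inj_on_def)
    qed
    show "(\<lambda>(S, v). (insert v S, v)) ` Sigma (indep T R k) A \<subseteq> Sigma (indep T R (Suc k)) (\<lambda>S. S)"
    proof -
      have "insert v S \<in> indep T R (Suc k)" if S: "S \<in> indep T R k" and v: "v \<in> A S" for S v
      proof -
        have "card (insert v S) = Suc k"
          using notin[OF S v] fin[OF S] S by (simp add: indep_def)
        moreover have "\<forall>p\<in>S. \<not> R p v \<and> \<not> R v p" using v sym by (auto simp: A_def)
        ultimately show ?thesis using S v by (auto simp: indep_def A_def)
      qed
      then show ?thesis by auto
    qed
    show "finite (Sigma (indep T R (Suc k)) (\<lambda>S. S))"
      using finite_indep[OF T] fin by (intro finite_SigmaI) auto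
  qed
  also have "\<dots> = (\<Sum>S\<in>indep T R (Suc k). card S)"
    using finite_indep[OF T] fin by (subst card_SigmaI) auto
  also have "\<dots> = Suc k * card (indep T R (Suc k))" by (simp add: indep_def)
  finally show ?thesis .
qed

text \<open>Up to size \<open>K\<close>, at least half of \<open>T\<close> stays available, hence at
  least \<open>K * \<Delta>\<close> extensions at every step. Dividing by the orderings gives
  \<open>(K * \<Delta>) ^ K / fact K\<close>, and \<open>fact K \<le> K ^ K\<close> removes the
  factor \<open>K ^ K\<close>.\<close>

lemma card_indep_ge:
  assumes T: "finite T" and refl: "\<And>p. p \<in> T \<Longrightarrow> R p p" and sym: "\<And>p q. R p q \<Longrightarrow> R q p"
    and deg: "\<And>p. p \<in> T \<Longrightarrow> card {q \<in> T. R p q} \<le> \<Delta>"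
    and K: "2 * K * \<Delta> \<le> card T"
  shows "\<Delta> ^ K \<le> card (indep T R K)"
proof -
  have "(K * \<Delta>) ^ k \<le> fact k * card (indep T R k)" if "k \<le> K" for k
    using that
  proof (induction k)
    case 0
    have "indep T R 0 = {{}}"
      using T by (auto simp: indep_def dest: finite_subset)
    then show ?case by simp
  next
    case (Suc k)
    have "k * \<Delta> \<le> K * \<Delta>" using Suc by simp
    then have "K * \<Delta> + k * \<Delta> \<le> card T" using K by linarith
    from card_indep_Suc[OF T refl sym deg this]
    have step: "K * \<Delta> * card (indep T R k) \<le> Suc k * card (indep T R (Suc k))" .
    have "(K * \<Delta>) ^ Suc k \<le> K * \<Delta> * (fact k * card (indep T R k))"
      using Suc by (simp del: mult_le_cancel1)
    also have "\<dots> = fact k * (K * \<Delta> * card (indep T R k))" by (simp only: ac_simps)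
    also have "\<dots> \<le> fact k * (Suc k * card (indep T R (Suc k)))" using step by (intro mult_left_mono) auto
    also have "\<dots> = fact (Suc k) * card (indep T R (Suc k))" by (simp add: algebra_simps)
    finally show ?case .
  qed
  from this[of K] have "K ^ K * \<Delta> ^ K \<le> fact K * card (indep T R K)" by (simp add: power_mult_distrib)
  also have "\<dots> \<le> K ^ K * card (indep T R K)" using fact_le_power[of K, where ?'a = nat] by simp
  finally show ?thesis by (cases "K = 0") auto
qed

section \<open>Trades\<close>

text \<open>The design axioms for two named halves, so that blocks can be exchanged without
  unpacking the partition each time.\<close>

definition is_bbd :: "'a set \<Rightarrow> 'a set \<Rightarrow> 'a set set \<Rightarrow> bool" where
  "is_bbd g1 g2 B \<longleftrightarrow>
     (\<forall>b\<in>B. b \<subseteq> g1 \<union> g2 \<and> card b = 4 \<and> card (b \<inter> g1) = 2 \<and> card (b \<inter> g2) = 2) \<and>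
     (\<forall>s. s \<subseteq> g1 \<union> g2 \<and> card s = 3 \<and> s \<inter> g1 \<noteq> {} \<and> s \<inter> g2 \<noteq> {} \<longrightarrow> (\<exists>!b. b \<in> B \<and> s \<subseteq> b))"

text \<open>Let \<open>b\<close> be the block of \<open>B\<close> containing a mixed triple. If
  \<open>b\<close> belongs to \<open>old p\<close>, a unique block of \<open>new p\<close> takes
  over, and disjointness of the old parts keeps other trades away. If \<open>b\<close> survives, no
  new block contains the triple, since by \<open>cover\<close> the matching old part would have
  contained \<open>b\<close>.\<close>

lemma is_bbd_replace_trades:
  assumes B: "is_bbd g1 g2 B"
    and old: "\<And>p. p \<in> S \<Longrightarrow> old p \<subseteq> B"
    and new: "\<And>p b. p \<in> S \<Longrightarrow> b \<in> new p \<Longrightarrow>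
        b \<subseteq> g1 \<union> g2 \<and> card b = 4 \<and> card (b \<inter> g1) = 2 \<and> card (b \<inter> g2) = 2"
    and cover: "\<And>p s. p \<in> S \<Longrightarrow> card s = 3 \<Longrightarrow> (\<exists>b\<in>old p. s \<subseteq> b) \<longleftrightarrow> (\<exists>b\<in>new p. s \<subseteq> b)"
    and uniq: "\<And>p s b b'. p \<in> S \<Longrightarrow> card s = 3 \<Longrightarrow> b \<in> new p \<Longrightarrow> b' \<in> new p \<Longrightarrow> s \<subseteq> b \<Longrightarrow> s \<subseteq> b' \<Longrightarrow> b = b'"
    and disj: "\<And>p q. p \<in> S \<Longrightarrow> q \<in> S \<Longrightarrow> p \<noteq> q \<Longrightarrow> old p \<inter> old q = {}"
  shows "is_bbd g1 g2 ((B - (\<Union>p\<in>S. old p)) \<union> (\<Union>p\<in>S. new p))"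
proof -
  let ?B = "(B - (\<Union>p\<in>S. old p)) \<union> (\<Union>p\<in>S. new p)"
  have "\<exists>!b. b \<in> ?B \<and> s \<subseteq> b"
    if s: "s \<subseteq> g1 \<union> g2" "card s = 3" "s \<inter> g1 \<noteq> {}" "s \<inter> g2 \<noteq> {}" for s
  proof -
    have ex1: "\<exists>!b. b \<in> B \<and> s \<subseteq> b" using B s by (simp add: is_bbd_def)
    then obtain b where b: "b \<in> B" "s \<subseteq> b" and bu: "\<And>c. c \<in> B \<Longrightarrow> s \<subseteq> c \<Longrightarrow> c = b" by blast
    have via_new: "b \<in> old p" if "p \<in> S" "c \<in> new p" "s \<subseteq> c" for p c
      using cover[OF that(1) s(2)] that old bu by blast
    show ?thesis
    proof (cases "\<exists>p\<in>S. b \<in> old p")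
      case True
      then obtain p where p: "p \<in> S" "b \<in> old p" by blast
      obtain c where c: "c \<in> new p" "s \<subseteq> c" using cover[OF p(1) s(2)] p b by blast
      show ?thesis
      proof (rule ex1I)
        show "c \<in> ?B \<and> s \<subseteq> c" using c p by blast
        fix c' assume c': "c' \<in> ?B \<and> s \<subseteq> c'"
        then obtain q where q: "q \<in> S" "c' \<in> new q" using bu p by blast
        then have "b \<in> old q" using via_new c' by blast
        then have "q = p" using disj p q by blast
        then show "c' = c" using uniq[OF p(1) s(2)] c c' q by blast
      qed
    next
      case False
      show ?thesis
      proof (rule ex1I)
        show "b \<in> ?B \<and> s \<subseteq> b" using b False by blast
        fix c assume c: "c \<in> ?B \<and> s \<subseteq> c"
        then have "c \<notin> new p" if "p \<in> S" for p using via_new[OF that] False that by blast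
        then show "c = b" using bu c by blast
      qed
    qed
  qed
  moreover have "\<forall>b\<in>?B. b \<subseteq> g1 \<union> g2 \<and> card b = 4 \<and> card (b \<inter> g1) = 2 \<and> card (b \<inter> g2) = 2"
    using B new by (auto simp: is_bbd_def)
  ultimately show ?thesis by (simp add: is_bbd_def)
qed

section \<open>The base design of a one-factorization\<close>

definition base_blocks :: "nat \<Rightarrow> (nat \<Rightarrow> nat \<Rightarrow> 'c) \<Rightarrow> nat set set" where
  "base_blocks m col = {{x, y, m + z, m + w} | x y z w.
     x < m \<and> y < m \<and> z < m \<and> w < m \<and> x \<noteq> y \<and> z \<noteq> w \<and> col x y = col z w}"

lemma block_sizes:
  fixes m :: nat
  assumes "x < m" "y < m" "z < m" "w < m" "x \<noteq> y" "z \<noteq> w"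
  defines "b \<equiv> {x, y, m + z, m + w}"
  shows "b \<subseteq> {0..<m} \<union> {m..<2 * m}" "card b = 4"
    "b \<inter> {0..<m} = {x, y}" "b \<inter> {m..<2 * m} = {m + z, m + w}"
    "card (b \<inter> {0..<m}) = 2" "card (b \<inter> {m..<2 * m}) = 2"
proof -
  show "b \<inter> {0..<m} = {x, y}" "b \<inter> {m..<2 * m} = {m + z, m + w}"
    using assms(1-6) by (auto simp: b_def)
  then show "card (b \<inter> {0..<m}) = 2" "card (b \<inter> {m..<2 * m}) = 2"
    using assms(5,6) by simp_all
  show "b \<subseteq> {0..<m} \<union> {m..<2 * m}" "card b = 4"
    using assms(1-6) by (auto simp: b_def)
qed

lemma mixed_triple_cases:
  fixes s :: "nat set"
  assumes s: "s \<subseteq> {0..<m} \<union> {m..<2 * m}" "card s = 3" "s \<inter> {0..<m} \<noteq> {}" "s \<inter> {m..<2 * m} \<noteq> {}"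
  obtains (left) x y z where "s = {x, y, m + z}" "x < m" "y < m" "z < m" "x \<noteq> y"
    | (right) x y z where "s = {x, m + y, m + z}" "x < m" "y < m" "z < m" "y \<noteq> z"
proof -
  have fin: "finite s" using s(2) card.infinite by force
  have split: "s = (s \<inter> {0..<m}) \<union> (s \<inter> {m..<2 * m})" using s(1) by blast
  have "card (s \<inter> {0..<m}) + card (s \<inter> {m..<2 * m}) = 3"
    using s(2) fin by (subst card_Un_disjoint[symmetric]) (auto simp flip: split)
  moreover have "card (s \<inter> {0..<m}) > 0" "card (s \<inter> {m..<2 * m}) > 0"
    using s fin by (auto simp: card_gt_0_iff)
  ultimately consider "card (s \<inter> {0..<m}) = 2" "card (s \<inter> {m..<2 * m}) = 1"
    | "card (s \<inter> {0..<m}) = 1" "card (s \<inter> {m..<2 * m}) = 2" by linarith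
  then show ?thesis
  proof cases
    case 1
    obtain x y where xy: "s \<inter> {0..<m} = {x, y}" "x \<noteq> y" using 1(1) by (auto simp: card_2_iff)
    obtain v where v: "s \<inter> {m..<2 * m} = {v}" using 1(2) by (auto simp: card_1_singleton_iff)
    have "x < m" "y < m" using xy(1) by auto
    moreover have "v \<in> {m..<2 * m}" using v by blast
    then obtain z where "v = m + z" "z < m" by (auto dest!: le_Suc_ex)
    moreover have "s = {x, y, v}" using split xy(1) v by auto
    ultimately show ?thesis using left xy(2) by blast
  next
    case 2
    obtain x where x: "s \<inter> {0..<m} = {x}" using 2(1) by (auto simp: card_1_singleton_iff)
    obtain v v' where v: "s \<inter> {m..<2 * m} = {v, v'}" "v \<noteq> v'" using 2(2) by (auto simp: card_2_iff)
    have "x < m" using x by auto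
    moreover have "v \<in> {m..<2 * m}" "v' \<in> {m..<2 * m}" using v by blast+
    then obtain y z where "v = m + y" "y < m" "v' = m + z" "z < m" by (auto dest!: le_Suc_ex)
    moreover have "s = {x, v, v'}" using split x v by auto
    ultimately show ?thesis using right v(2) by blast
  qed
qed

text \<open>Given two points of one half and a point \<open>z\<close> of the other, the colour of
  the pair occurs on exactly one edge at \<open>z\<close>, and that edge completes the
  block.\<close>

lemma is_bbd_base_blocks:
  assumes F: "one_factorization {0..<m} C col"
  shows "is_bbd {0..<m} {m..<2 * m} (base_blocks m col)"
proof -
  have sym: "col x y = col y x" if "x < m" "y < m" for x y
    using one_factorization_sym[OF F] that by simp
  have inj: "y = z" if "col x y = col x z" "x < m" "y < m" "z < m" "x \<noteq> y" "x \<noteq> z" for x y z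
    using one_factorization_inj[OF F, of x y z] that by simp
  have ex: "\<exists>w<m. w \<noteq> z \<and> col z w = col x y" if "x < m" "y < m" "x \<noteq> y" "z < m" for x y z
    using one_factorization_obtain[OF F, of z "col x y"] one_factorization_in[OF F, of x y] that
    by (metis atLeastLessThan_iff zero_le)
  have ex1: "\<exists>!b. b \<in> base_blocks m col \<and> s \<subseteq> b"
    if s: "s \<subseteq> {0..<m} \<union> {m..<2 * m}" "card s = 3" "s \<inter> {0..<m} \<noteq> {}" "s \<inter> {m..<2 * m} \<noteq> {}" for s
    using s
  proof (cases rule: mixed_triple_cases)
    case (left x y z)
    obtain w where w: "w < m" "w \<noteq> z" "col z w = col x y" using ex left by blast
    show ?thesis
    proof (rule ex1I)
      show "{x, y, m + z, m + w} \<in> base_blocks m col \<and> s \<subseteq> {x, y, m + z, m + w}"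
        using left w unfolding base_blocks_def by fastforce
      fix b assume b: "b \<in> base_blocks m col \<and> s \<subseteq> b"
      then obtain x' y' z' w' where b': "b = {x', y', m + z', m + w'}"
        and lt: "x' < m" "y' < m" "z' < m" "w' < m" and ne: "x' \<noteq> y'" "z' \<noteq> w'" and c: "col x' y' = col z' w'"
        unfolding base_blocks_def by blast
      have xy: "{x, y} = {x', y'}" using b b' left lt by auto
      then have cxy: "col x y = col z' w'" using c sym left by (auto simp: doubleton_eq_iff)
      consider "z = z'" | "z = w'" using b b' left lt by auto
      then have "{z', w'} = {z, w}"
      proof cases
        case 1
        then show ?thesis using inj[of z w w'] w cxy lt ne by auto
      next
        case 2
        then show ?thesis using inj[of z w z'] w cxy lt ne sym[of z' w'] by auto
      qed
      then show "b = {x, y, m + z, m + w}" using b' xy by (auto simp: doubleton_eq_iff)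
    qed
  next
    case (right z x y)
    obtain w where w: "w < m" "w \<noteq> z" "col z w = col x y" using ex right by blast
    show ?thesis
    proof (rule ex1I)
      show "{z, w, m + x, m + y} \<in> base_blocks m col \<and> s \<subseteq> {z, w, m + x, m + y}"
        using right w unfolding base_blocks_def by fastforce
      fix b assume b: "b \<in> base_blocks m col \<and> s \<subseteq> b"
      then obtain z' w' x' y' where b': "b = {z', w', m + x', m + y'}"
        and lt: "x' < m" "y' < m" "z' < m" "w' < m" and ne: "x' \<noteq> y'" "z' \<noteq> w'" and c: "col z' w' = col x' y'"
        unfolding base_blocks_def by blast
      have xy: "{x, y} = {x', y'}" using b b' right lt by auto
      then have cxy: "col x y = col z' w'" using c sym right by (auto simp: doubleton_eq_iff)
      consider "z = z'" | "z = w'" using b b' right lt by auto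
      then have "{z', w'} = {z, w}"
      proof cases
        case 1
        then show ?thesis using inj[of z w w'] w cxy lt ne by auto
      next
        case 2
        then show ?thesis using inj[of z w z'] w cxy lt ne sym[of z' w'] by auto
      qed
      then show "b = {z, w, m + x, m + y}" using b' xy by (auto simp: doubleton_eq_iff)
    qed
  qed
  have sizes: "b \<subseteq> {0..<m} \<union> {m..<2 * m} \<and> card b = 4 \<and>
      card (b \<inter> {0..<m}) = 2 \<and> card (b \<inter> {m..<2 * m}) = 2" if b: "b \<in> base_blocks m col" for b
  proof -
    obtain x y z w where b': "b = {x, y, m + z, m + w}" and xyzw: "x < m" "y < m" "z < m" "w < m" "x \<noteq> y" "z \<noteq> w"
      using b unfolding base_blocks_def by blast
    show ?thesis unfolding b' using block_sizes[OF xyzw] by blast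
  qed
  show ?thesis unfolding is_bbd_def
    by (intro conjI[of "Ball _ _"] ballI allI impI) (erule sizes, elim conjE, rule ex1)
qed

lemma three_subset_of_four:
  assumes "s \<subseteq> {a, b, c, d}" "card s = 3" "card {a, b, c, d} = 4"
  shows "s = {b, c, d} \<or> s = {a, c, d} \<or> s = {a, b, d} \<or> s = {a, b, c}"
proof -
  have ne: "s \<noteq> {a, b, c, d}"
  proof
    assume "s = {a, b, c, d}"
    then have "card s = 4" using assms(3) by (rule ssubst)
    with assms(2) show False by simp
  qed
  have eq: "s = {x, y, z}" if "s \<subseteq> {x, y, z}" for x y z
  proof (rule card_seteq)
    show "card {x, y, z} \<le> card s" unfolding assms(2) by (simp add: card_insert_if)
  qed (use that in simp_all)
  consider "a \<notin> s" | "b \<notin> s" | "c \<notin> s" | "d \<notin> s"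
    using ne assms(1) by blast
  then show ?thesis
  proof cases
    case 1
    then have "s \<subseteq> {b, c, d}" using assms(1) by blast
    from eq[OF this] show ?thesis by simp
  next
    case 2
    then have "s \<subseteq> {a, c, d}" using assms(1) by blast
    from eq[OF this] show ?thesis by simp
  next
    case 3
    then have "s \<subseteq> {a, b, d}" using assms(1) by blast
    from eq[OF this] show ?thesis by simp
  next
    case 4
    then have "s \<subseteq> {a, b, c}" using assms(1) by blast
    from eq[OF this] show ?thesis by simp
  qed
qed

section \<open>Trades inside the base design\<close>

text \<open>A block meeting \<open>{0..<q}\<close>, \<open>{q..<2 * q}\<close>, \<open>{m..<m + q}\<close> and \<open>{m + q..<m + 2 * q}\<close>, where
\<open>q = 2 ^ Suc t\<close>. It is a base block iff its coordinates have XOR-sum \<open>0\<close>; a trade replaces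
eight such blocks by eight blocks of sum \<open>d\<close>. Taking \<open>a, b, c\<close> without and \<open>d\<close> with the top bit
\<open>2 ^ t\<close> makes the parameters of a trade unique.\<close>

definition cell :: "nat \<Rightarrow> nat \<Rightarrow> nat \<Rightarrow> nat \<Rightarrow> nat \<Rightarrow> nat \<Rightarrow> nat set" where
  "cell m t x y z w = {x, 2 ^ Suc t XOR y, m + z, m + (2 ^ Suc t XOR w)}"

text \<open>The values 0 and \<open>d\<close> of \<open>e\<close> split a 2 x 2 x 2 x 2 grid of
  cells, with fourth coordinate \<open>a XOR b XOR c\<close> or its flip by \<open>d\<close>: an
  even number of flips for \<open>e = 0\<close>, an odd number for \<open>e = d\<close>.\<close>

fun trade :: "nat \<Rightarrow> nat \<Rightarrow> nat \<Rightarrow> nat \<times> nat \<times> nat \<times> nat \<Rightarrow> nat set set" where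
  "trade m t e (a, b, c, d) = {cell m t x y z (x XOR y XOR z XOR e) | x y z.
     x \<in> {a, a XOR d} \<and> y \<in> {b, b XOR d} \<and> z \<in> {c, c XOR d}}"

fun new_trade :: "nat \<Rightarrow> nat \<Rightarrow> nat \<times> nat \<times> nat \<times> nat \<Rightarrow> nat set set" where
  "new_trade m t (a, b, c, d) = trade m t d (a, b, c, d)"

definition params :: "nat \<Rightarrow> (nat \<times> nat \<times> nat \<times> nat) set" where
  "params t = {0..<2 ^ t} \<times> {0..<2 ^ t} \<times> {0..<2 ^ t} \<times> {2 ^ t..<2 ^ Suc t}"

text \<open>The exponent \<open>t + 2\<close> provides the \<open>t\<close> low bits of the
  parameters, bit \<open>t\<close> as the mark of \<open>d\<close>, and bit \<open>t + 1\<close> to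
  separate the two points of a cell in the same half.\<close>

locale xor_one_factorization =
  fixes m t :: nat and C :: "(nat + int) set" and col :: "nat \<Rightarrow> nat \<Rightarrow> nat + int"
  assumes F: "one_factorization {0..<m} C col"
    and col_xor: "\<And>x y. x < 2 ^ (t + 2) \<Longrightarrow> y < 2 ^ (t + 2) \<Longrightarrow> col x y = Inl (x XOR y)"
    and m: "2 ^ (t + 2) \<le> m"
begin

abbreviation q :: nat where "q \<equiv> 2 ^ Suc t"

text \<open>Shifting by XOR with \<open>q\<close> rather than by addition lands in
  \<open>{q..<2 * q}\<close> and lets \<open>q\<close> cancel when colours are compared.\<close>

lemma high: "y < q \<Longrightarrow> q \<le> q XOR y" "y < q \<Longrightarrow> q XOR y < 2 * q"
  using xor_high_bit[of y "Suc t" q] by simp_all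

lemma qm: "2 * q \<le> m"
  using m by (simp add: numeral_2_eq_2)

lemma cell_mem:
  assumes "x < q" "y < q" "z < q" "w < q"
  shows "x' < q \<Longrightarrow> x' \<in> cell m t x y z w \<longleftrightarrow> x' = x"
    and "y' < q \<Longrightarrow> q XOR y' \<in> cell m t x y z w \<longleftrightarrow> y' = y"
    and "z' < q \<Longrightarrow> m + z' \<in> cell m t x y z w \<longleftrightarrow> z' = z"
    and "w' < q \<Longrightarrow> m + (q XOR w') \<in> cell m t x y z w \<longleftrightarrow> w' = w"
proof -
  show "x' < q \<Longrightarrow> x' \<in> cell m t x y z w \<longleftrightarrow> x' = x"
    unfolding cell_def using assms high(1)[of y] qm by auto
  show "y' < q \<Longrightarrow> q XOR y' \<in> cell m t x y z w \<longleftrightarrow> y' = y"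
    unfolding cell_def using assms high[of y'] qm by (auto simp del: power_Suc)
  show "z' < q \<Longrightarrow> m + z' \<in> cell m t x y z w \<longleftrightarrow> z' = z"
    unfolding cell_def using assms high[of y] high(1)[of w] qm by (auto simp del: power_Suc)
  show "w' < q \<Longrightarrow> m + (q XOR w') \<in> cell m t x y z w \<longleftrightarrow> w' = w"
    unfolding cell_def using assms high[of y] high(1)[of w'] qm by (auto simp del: power_Suc)
qed

lemma cell_inj:
  assumes "x < q" "y < q" "z < q" "w < q" "x' < q" "y' < q" "z' < q" "w' < q"
    and "cell m t x y z w = cell m t x' y' z' w'"
  shows "x = x'" "y = y'" "z = z'" "w = w'"
proof -
  have "x \<in> cell m t x' y' z' w'" "q XOR y \<in> cell m t x' y' z' w'" "m + z \<in> cell m t x' y' z' w'"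
    "m + (q XOR w) \<in> cell m t x' y' z' w'"
    unfolding assms(9)[symmetric] by (simp_all add: cell_def)
  then show "x = x'" "y = y'" "z = z'" "w = w'"
    using cell_mem[OF assms(5-8)] assms(1-4) by blast+
qed

lemma cell_sizes:
  assumes "x < q" "y < q" "z < q" "w < q"
  shows "cell m t x y z w \<subseteq> {0..<m} \<union> {m..<2 * m}" "card (cell m t x y z w) = 4"
    "cell m t x y z w \<inter> {0..<m} = {x, q XOR y}"
    "cell m t x y z w \<inter> {m..<2 * m} = {m + z, m + (q XOR w)}"
    "card (cell m t x y z w \<inter> {0..<m}) = 2" "card (cell m t x y z w \<inter> {m..<2 * m}) = 2"
proof -
  have "x < m" "q XOR y < m" "z < m" "q XOR w < m" "x \<noteq> q XOR y" "z \<noteq> q XOR w"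
    using assms high[of y] high[of w] qm by linarith+
  note * = block_sizes[OF this, folded cell_def]
  show "cell m t x y z w \<subseteq> {0..<m} \<union> {m..<2 * m}" "card (cell m t x y z w) = 4"
    "cell m t x y z w \<inter> {0..<m} = {x, q XOR y}"
    "cell m t x y z w \<inter> {m..<2 * m} = {m + z, m + (q XOR w)}"
    "card (cell m t x y z w \<inter> {0..<m}) = 2" "card (cell m t x y z w \<inter> {m..<2 * m}) = 2"
    by (rule *)+
qed

text \<open>Each half meets the cell in an unordered pair, so by symmetry of \<open>col\<close>
  being a base block is one colour equation between these pairs, in which the two occurrences of
  \<open>q\<close> cancel.\<close>

lemma cell_in_base_iff:
  assumes "x < q" "y < q" "z < q" "w < q"
  shows "cell m t x y z w \<in> base_blocks m col \<longleftrightarrow> x XOR y XOR z XOR w = 0"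
proof -
  have lt: "x < m" "q XOR y < m" "z < m" "q XOR w < m" "x \<noteq> q XOR y" "z \<noteq> q XOR w"
    using assms high[of y] high[of w] qm by linarith+
  have r: "x < 2 ^ (t + 2)" "q XOR y < 2 ^ (t + 2)" "z < 2 ^ (t + 2)" "q XOR w < 2 ^ (t + 2)"
    using assms high[of y] high[of w] by (auto simp: numeral_2_eq_2)
  have "cell m t x y z w \<in> base_blocks m col \<longleftrightarrow> col x (q XOR y) = col z (q XOR w)"
  proof
    assume "col x (q XOR y) = col z (q XOR w)"
    then show "cell m t x y z w \<in> base_blocks m col"
      unfolding base_blocks_def cell_def using lt by blast
  next
    assume "cell m t x y z w \<in> base_blocks m col"
    then obtain x' y' z' w' where b: "cell m t x y z w = {x', y', m + z', m + w'}"
      and b': "x' < m" "y' < m" "z' < m" "w' < m" "x' \<noteq> y'" "z' \<noteq> w'" and c: "col x' y' = col z' w'"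
      unfolding base_blocks_def by blast
    have "{x, q XOR y} = {x', y'}" "{m + z, m + (q XOR w)} = {m + z', m + w'}"
      using cell_sizes(3,4)[OF assms] block_sizes(3,4)[OF b'] unfolding b by auto
    moreover have "col x' y' = col y' x'" "col z' w' = col w' z'"
      using one_factorization_sym[OF F] b' by auto
    ultimately show "col x (q XOR y) = col z (q XOR w)"
      using c by (auto simp: doubleton_eq_iff)
  qed
  also have "\<dots> \<longleftrightarrow> x XOR (q XOR y) = z XOR (q XOR w)" using col_xor r by simp
  also have "\<dots> \<longleftrightarrow> q XOR (x XOR y) = q XOR (z XOR w)" by (simp only: ac_simps)
  also have "\<dots> \<longleftrightarrow> x XOR y = z XOR w" by simp
  also have "\<dots> \<longleftrightarrow> (x XOR y) XOR (z XOR w) = 0" by (rule xor_eq_0_iff_nat[symmetric])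
  finally show ?thesis by (simp only: xor.assoc)
qed

lemma trade_coords:
  assumes p: "(a, b, c, d) \<in> params t" and e: "e = 0 \<or> e = d"
    and xyz: "x \<in> {a, a XOR d}" "y \<in> {b, b XOR d}" "z \<in> {c, c XOR d}"
  shows "x < q" "y < q" "z < q" "x XOR y XOR z XOR e < q"
proof -
  have "a < q" "b < q" "c < q" "d < q" using p by (auto simp: params_def)
  then show "x < q" "y < q" "z < q" using xyz by (auto intro: xor_less_power2 simp del: power_Suc)
  moreover have "e < q" using e \<open>d < q\<close> by auto
  ultimately show "x XOR y XOR z XOR e < q" by (intro xor_less_power2)
qed

text \<open>A triple in a cell omits one point. Flipping the omitted coordinate by \<open>d\<close>
  changes the XOR-sum by \<open>d\<close> and leaves the triple in place; if the fourth coordinate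
  is omitted, changing \<open>e\<close> does the flip.\<close>

lemma trade_cover:
  assumes p: "(a, b, c, d) \<in> params t" and e: "e = 0 \<or> e = d" and s: "card s = 3"
    and B: "B \<in> trade m t e (a, b, c, d)" "s \<subseteq> B"
  shows "\<exists>B' \<in> trade m t (e XOR d) (a, b, c, d). s \<subseteq> B'"
proof -
  obtain x y z where xyz: "x \<in> {a, a XOR d}" "y \<in> {b, b XOR d}" "z \<in> {c, c XOR d}"
    and B': "B = cell m t x y z (x XOR y XOR z XOR e)"
    using B(1) by auto
  have "card B = 4" unfolding B' using trade_coords[OF p e xyz] by (rule cell_sizes)
  then have cases: "s = {q XOR y, m + z, m + (q XOR (x XOR y XOR z XOR e))} \<or>
      s = {x, m + z, m + (q XOR (x XOR y XOR z XOR e))} \<or>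
      s = {x, q XOR y, m + (q XOR (x XOR y XOR z XOR e))} \<or> s = {x, q XOR y, m + z}"
    using three_subset_of_four[of s] s B(2) unfolding B' cell_def by blast
  have tr: "cell m t x' y' z' w' \<in> trade m t (e XOR d) (a, b, c, d)"
    if "x' \<in> {a, a XOR d}" "y' \<in> {b, b XOR d}" "z' \<in> {c, c XOR d}" "w' = x' XOR y' XOR z' XOR (e XOR d)"
    for x' y' z' w'
    using that by auto
  have flip: "x XOR d \<in> {a, a XOR d}" "y XOR d \<in> {b, b XOR d}" "z XOR d \<in> {c, c XOR d}"
    using xyz by auto
  have w: "x XOR y XOR z XOR e = (x XOR d) XOR y XOR z XOR (e XOR d)"
    "x XOR y XOR z XOR e = x XOR (y XOR d) XOR z XOR (e XOR d)"
    "x XOR y XOR z XOR e = x XOR y XOR (z XOR d) XOR (e XOR d)"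
    by (simp_all add: ac_simps)
  from cases show ?thesis
  proof (elim disjE)
    assume "s = {q XOR y, m + z, m + (q XOR (x XOR y XOR z XOR e))}"
    then show ?thesis using tr[OF flip(1) xyz(2,3) w(1)] by (rule_tac bexI) (auto simp: cell_def)
  next
    assume "s = {x, m + z, m + (q XOR (x XOR y XOR z XOR e))}"
    then show ?thesis using tr[OF xyz(1) flip(2) xyz(3) w(2)] by (rule_tac bexI) (auto simp: cell_def)
  next
    assume "s = {x, q XOR y, m + (q XOR (x XOR y XOR z XOR e))}"
    then show ?thesis using tr[OF xyz(1,2) flip(3) w(3)] by (rule_tac bexI) (auto simp: cell_def)
  next
    assume "s = {x, q XOR y, m + z}"
    then show ?thesis using tr[OF xyz refl] by (rule_tac bexI) (auto simp: cell_def)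
  qed
qed

text \<open>Three coordinates of a cell determine the fourth, because the XOR-sum is fixed to
  \<open>e\<close>.\<close>

lemma trade_unique:
  assumes p: "(a, b, c, d) \<in> params t" and e: "e = 0 \<or> e = d" and s: "card s = 3"
    and B: "B \<in> trade m t e (a, b, c, d)" "s \<subseteq> B"
    and B': "B' \<in> trade m t e (a, b, c, d)" "s \<subseteq> B'"
  shows "B = B'"
proof -
  obtain x y z where xyz: "x \<in> {a, a XOR d}" "y \<in> {b, b XOR d}" "z \<in> {c, c XOR d}"
    and eq: "B = cell m t x y z (x XOR y XOR z XOR e)"
    using B(1) by auto
  obtain x' y' z' where xyz': "x' \<in> {a, a XOR d}" "y' \<in> {b, b XOR d}" "z' \<in> {c, c XOR d}"
    and eq': "B' = cell m t x' y' z' (x' XOR y' XOR z' XOR e)"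
    using B'(1) by auto
  note lt = trade_coords[OF p e xyz] and lt' = trade_coords[OF p e xyz']
  have "card B = 4" unfolding eq using lt by (rule cell_sizes)
  then have cases: "s = {q XOR y, m + z, m + (q XOR (x XOR y XOR z XOR e))} \<or>
      s = {x, m + z, m + (q XOR (x XOR y XOR z XOR e))} \<or>
      s = {x, q XOR y, m + (q XOR (x XOR y XOR z XOR e))} \<or> s = {x, q XOR y, m + z}"
    using three_subset_of_four[of s] s B(2) unfolding eq cell_def by blast
  have c: "x \<in> s \<Longrightarrow> x = x'" "q XOR y \<in> s \<Longrightarrow> y = y'" "m + z \<in> s \<Longrightarrow> z = z'"
    "m + (q XOR (x XOR y XOR z XOR e)) \<in> s \<Longrightarrow> x XOR y XOR z XOR e = x' XOR y' XOR z' XOR e"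
    using B'(2) cell_mem[OF lt'] lt unfolding eq' by blast+
  have "x = x' \<and> y = y' \<and> z = z'"
    using cases
  proof (elim disjE)
    assume "s = {q XOR y, m + z, m + (q XOR (x XOR y XOR z XOR e))}"
    then have "y = y'" "z = z'" "x XOR y XOR z XOR e = x' XOR y' XOR z' XOR e" using c by auto
    then show ?thesis by (metis xor.commute xor_left_inj)
  next
    assume "s = {x, m + z, m + (q XOR (x XOR y XOR z XOR e))}"
    then have "x = x'" "z = z'" "x XOR y XOR z XOR e = x' XOR y' XOR z' XOR e" using c by auto
    then show ?thesis by (metis xor.commute xor_left_inj)
  next
    assume "s = {x, q XOR y, m + (q XOR (x XOR y XOR z XOR e))}"
    then have "x = x'" "y = y'" "x XOR y XOR z XOR e = x' XOR y' XOR z' XOR e" using c by auto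
    then show ?thesis by (metis xor.commute xor_left_inj)
  next
    assume "s = {x, q XOR y, m + z}"
    then show ?thesis using c by auto
  qed
  then show ?thesis using eq eq' by simp
qed

text \<open>Since \<open>d\<close> carries bit \<open>t\<close> and \<open>a\<close> does not,
  \<open>a\<close> is the only member of \<open>{a, a XOR d}\<close> below
  \<open>2 ^ t\<close>.\<close>

lemma low_coord:
  fixes a d x :: nat
  assumes "a < 2 ^ t" "d \<in> {2 ^ t..<2 ^ Suc t}" "x \<in> {a, a XOR d}"
  shows "a = (if x < 2 ^ t then x else x XOR d)"
  using assms xor_high_bit(1)[of a t d] by (auto simp: ac_simps)

lemma params_from_coords:
  assumes "(a, b, c, d) \<in> params t" "x \<in> {a, a XOR d}" "y \<in> {b, b XOR d}" "z \<in> {c, c XOR d}"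
  shows "(a, b, c, d) = (if x < 2 ^ t then x else x XOR d, if y < 2 ^ t then y else y XOR d,
    if z < 2 ^ t then z else z XOR d, d)"
  using assms low_coord[of a d x] low_coord[of b d y] low_coord[of c d z]
  by (simp add: params_def del: power_Suc)

text \<open>The XOR-sum of a new cell is \<open>d\<close> itself; once \<open>d\<close> is known,
  the coordinates give back \<open>a\<close>, \<open>b\<close> and \<open>c\<close>.\<close>

lemma new_trade_disjoint:
  assumes p: "p \<in> params t" "p' \<in> params t" and B: "B \<in> new_trade m t p" "B \<in> new_trade m t p'"
  shows "p = p'"
proof -
  obtain a b c d where p1: "p = (a, b, c, d)" by (cases p) auto
  obtain a' b' c' d' where p2: "p' = (a', b', c', d')" by (cases p') auto
  obtain x y z where xyz: "x \<in> {a, a XOR d}" "y \<in> {b, b XOR d}" "z \<in> {c, c XOR d}"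
    and eq: "B = cell m t x y z (x XOR y XOR z XOR d)"
    using B(1) p1 by auto
  obtain x' y' z' where xyz': "x' \<in> {a', a' XOR d'}" "y' \<in> {b', b' XOR d'}" "z' \<in> {c', c' XOR d'}"
    and eq': "B = cell m t x' y' z' (x' XOR y' XOR z' XOR d')"
    using B(2) p2 by auto
  note inj = cell_inj[OF trade_coords[OF p(1)[unfolded p1] disjI2[OF refl] xyz]
      trade_coords[OF p(2)[unfolded p2] disjI2[OF refl] xyz'] eq[symmetric, THEN trans, OF eq']]
  have "d = d'" using inj by simp
  then show ?thesis
    using params_from_coords[OF p(1)[unfolded p1] xyz] params_from_coords[OF p(2)[unfolded p2] xyz'] inj p1 p2
    by simp
qed

definition conflict :: "nat \<times> nat \<times> nat \<times> nat \<Rightarrow> nat \<times> nat \<times> nat \<times> nat \<Rightarrow> bool" where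
  "conflict p p' \<longleftrightarrow> trade m t 0 p \<inter> trade m t 0 p' \<noteq> {}"

text \<open>A conflicting trade shares one of the eight cells of \<open>p\<close>. Old cells have
  XOR-sum 0 and do not reveal \<open>d\<close>, so its \<open>2 ^ t\<close> values stay open; the
  cell and \<open>d\<close> fix the remaining parameters.\<close>

lemma card_conflict:
  assumes p: "p \<in> params t"
  shows "card {p' \<in> params t. conflict p p'} \<le> 8 * 2 ^ t"
proof -
  obtain a b c d where p1: "p = (a, b, c, d)" by (cases p) auto
  define f where "f = (\<lambda>(x, y, z, d). (if x < 2 ^ t then x else x XOR d, if y < 2 ^ t then y else y XOR d,
    if z < 2 ^ t then z else z XOR d, d :: nat))"
  let ?D = "{a, a XOR d} \<times> {b, b XOR d} \<times> {c, c XOR d} \<times> {2 ^ t..<2 ^ Suc t :: nat}"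
  have "{p' \<in> params t. conflict p p'} \<subseteq> f ` ?D"
  proof clarify
    fix a' b' c' d' assume p': "(a', b', c', d') \<in> params t" and "conflict p (a', b', c', d')"
    then obtain B where B: "B \<in> trade m t 0 p" "B \<in> trade m t 0 (a', b', c', d')"
      unfolding conflict_def by blast
    obtain x y z where xyz: "x \<in> {a, a XOR d}" "y \<in> {b, b XOR d}" "z \<in> {c, c XOR d}"
      and eq: "B = cell m t x y z (x XOR y XOR z XOR 0)"
      using B(1) p1 by auto
    obtain x' y' z' where xyz': "x' \<in> {a', a' XOR d'}" "y' \<in> {b', b' XOR d'}" "z' \<in> {c', c' XOR d'}"
      and eq': "B = cell m t x' y' z' (x' XOR y' XOR z' XOR 0)"
      using B(2) by auto
    note inj = cell_inj[OF trade_coords[OF p[unfolded p1] disjI1[OF refl] xyz]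
        trade_coords[OF p' disjI1[OF refl] xyz'] eq[symmetric, THEN trans, OF eq']]
    have "(a', b', c', d') = f (x, y, z, d')"
      using params_from_coords[OF p' xyz'] inj by (simp add: f_def)
    moreover have "(x, y, z, d') \<in> ?D" using xyz p' by (auto simp: params_def)
    ultimately show "(a', b', c', d') \<in> f ` ?D" by blast
  qed
  then have "card {p' \<in> params t. conflict p p'} \<le> card ?D"
    by (rule surj_card_le[rotated]) simp
  also have "\<dots> = card {a, a XOR d} * (card {b, b XOR d} * (card {c, c XOR d} * 2 ^ t))"
    by (simp only: card_cartesian_product) simp
  also have "\<dots> \<le> 2 * (2 * (2 * 2 ^ t))"
    by (intro mult_le_mono) (auto simp: card_insert_if)
  finally show ?thesis by simp
qed

definition switched :: "(nat \<times> nat \<times> nat \<times> nat) set \<Rightarrow> nat set set" where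
  "switched S = (base_blocks m col - (\<Union>p\<in>S. trade m t 0 p)) \<union> (\<Union>p\<in>S. new_trade m t p)"

lemma new_trade_not_base:
  assumes p: "p \<in> params t"
  shows "new_trade m t p \<inter> base_blocks m col = {}"
proof -
  obtain a b c d where p1: "p = (a, b, c, d)" by (cases p) auto
  have "d \<noteq> 0" using p p1 by (auto simp: params_def)
  have "cell m t x y z (x XOR y XOR z XOR d) \<notin> base_blocks m col"
    if xyz: "x \<in> {a, a XOR d}" "y \<in> {b, b XOR d}" "z \<in> {c, c XOR d}" for x y z
  proof -
    have "x XOR y XOR z XOR (x XOR y XOR z XOR d) = d" by (simp add: ac_simps)
    then show ?thesis
      using cell_in_base_iff[OF trade_coords[OF p[unfolded p1] disjI2[OF refl] xyz]] \<open>d \<noteq> 0\<close> by simp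
  qed
  then show ?thesis using p1 by auto
qed

text \<open>New cells have nonzero XOR-sum, hence are not base blocks, and distinct parameters share
  none; so \<open>S\<close> consists of the parameters whose new cells appear.\<close>

lemma inj_on_switched: "inj_on switched (Pow (params t))"
proof (rule inj_on_inverseI[where g = "\<lambda>B. {p \<in> params t. new_trade m t p \<inter> B \<noteq> {}}"])
  fix S assume "S \<in> Pow (params t)"
  then have S: "S \<subseteq> params t" by simp
  have ne: "new_trade m t p \<noteq> {}" for p by (cases p) auto
  show "{p \<in> params t. new_trade m t p \<inter> switched S \<noteq> {}} = S"
  proof (intro equalityI subsetI)
    fix p assume "p \<in> {p \<in> params t. new_trade m t p \<inter> switched S \<noteq> {}}"
    then obtain B where p: "p \<in> params t" "B \<in> new_trade m t p" "B \<in> switched S" by blast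
    then have "B \<notin> base_blocks m col" using new_trade_not_base by blast
    then obtain p' where "p' \<in> S" "B \<in> new_trade m t p'" using p(3) unfolding switched_def by blast
    then show "p \<in> S" using new_trade_disjoint[OF p(1) _ p(2)] S by blast
  next
    fix p assume p: "p \<in> S"
    then have "new_trade m t p \<subseteq> switched S" unfolding switched_def by blast
    then show "p \<in> {p \<in> params t. new_trade m t p \<inter> switched S \<noteq> {}}" using ne[of p] p S by blast
  qed
qed

lemma is_bbd_switched:
  assumes S: "S \<in> indep (params t) conflict K"
  shows "is_bbd {0..<m} {m..<2 * m} (switched S)"
  unfolding switched_def
proof (rule is_bbd_replace_trades)
  have par: "p \<in> params t" if "p \<in> S" for p using S that by (auto simp: indep_def)
  show "is_bbd {0..<m} {m..<2 * m} (base_blocks m col)" by (rule is_bbd_base_blocks[OF F])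
  show "trade m t 0 p \<subseteq> base_blocks m col" if "p \<in> S" for p
  proof -
    obtain a b c d where p1: "p = (a, b, c, d)" by (cases p) auto
    have "cell m t x y z (x XOR y XOR z XOR 0) \<in> base_blocks m col"
      if xyz: "x \<in> {a, a XOR d}" "y \<in> {b, b XOR d}" "z \<in> {c, c XOR d}" for x y z
    proof -
      have "x XOR y XOR z XOR (x XOR y XOR z XOR 0) = 0" by (simp add: ac_simps)
      then show ?thesis
        using cell_in_base_iff[OF trade_coords[OF par[OF \<open>p \<in> S\<close>, unfolded p1] disjI1[OF refl] xyz]] by simp
    qed
    then show ?thesis using p1 by auto
  qed
  show "B \<subseteq> {0..<m} \<union> {m..<2 * m} \<and> card B = 4 \<and> card (B \<inter> {0..<m}) = 2 \<and> card (B \<inter> {m..<2 * m}) = 2"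
    if "p \<in> S" "B \<in> new_trade m t p" for p B
  proof -
    obtain a b c d where p1: "p = (a, b, c, d)" by (cases p) auto
    obtain x y z where xyz: "x \<in> {a, a XOR d}" "y \<in> {b, b XOR d}" "z \<in> {c, c XOR d}"
      and eq: "B = cell m t x y z (x XOR y XOR z XOR d)"
      using \<open>B \<in> new_trade m t p\<close> p1 by auto
    show ?thesis unfolding eq
      using cell_sizes[OF trade_coords[OF par[OF \<open>p \<in> S\<close>, unfolded p1] disjI2[OF refl] xyz]] by blast
  qed
  show "(\<exists>b\<in>trade m t 0 p. s \<subseteq> b) \<longleftrightarrow> (\<exists>b\<in>new_trade m t p. s \<subseteq> b)" if "p \<in> S" "card s = 3" for p s
  proof -
    obtain a b c d where p1: "p = (a, b, c, d)" by (cases p) auto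
    note pp = par[OF \<open>p \<in> S\<close>, unfolded p1]
    show ?thesis
      using trade_cover[OF pp disjI1[OF refl] that(2)] trade_cover[OF pp disjI2[OF refl] that(2)]
      unfolding p1 new_trade.simps by (auto simp del: trade.simps)
  qed
  show "B = B'" if "p \<in> S" "card s = 3" "B \<in> new_trade m t p" "B' \<in> new_trade m t p" "s \<subseteq> B" "s \<subseteq> B'" for p s B B'
  proof -
    obtain a b c d where p1: "p = (a, b, c, d)" by (cases p) auto
    show ?thesis
      using trade_unique[OF par[OF \<open>p \<in> S\<close>, unfolded p1] disjI2[OF refl] that(2)] that unfolding p1 new_trade.simps by blast
  qed
  show "trade m t 0 p \<inter> trade m t 0 p' = {}" if "p \<in> S" "p' \<in> S" "p \<noteq> p'" for p p'
    using S that by (auto simp: indep_def conflict_def)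
qed

lemma many_designs:
  assumes t: "t \<ge> 2"
  shows "(8 * 2 ^ t) ^ ((2 ^ t) ^ 3 div 16) \<le> card {B. is_bbd {0..<m} {m..<2 * m} B}"
proof -
  \<comment> \<open>With \<open>2 ^ (4 * t)\<close> trades and \<open>\<Delta> = 8 * 2 ^ t\<close>,
    this is the largest \<open>K\<close> satisfying
    \<open>2 * K * \<Delta> \<le> card (params t)\<close>, as \<open>card_indep_ge\<close>
    demands.\<close>
  let ?K = "(2 ^ t) ^ 3 div 16 :: nat"
  have fin: "finite (params t)" by (simp add: params_def)
  have "card (params t) = 2 ^ t * (2 ^ t * (2 ^ t * 2 ^ t))" by (simp add: params_def card_cartesian_product)
  also have "\<dots> = (2 ^ t) ^ 3 * 2 ^ t" by (simp add: power3_eq_cube)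
  finally have card: "card (params t) = (2 ^ t) ^ 3 * 2 ^ t" .
  have "2 * ?K * (8 * 2 ^ t) = (16 * ?K) * 2 ^ t" by simp
  also have "\<dots> \<le> (2 ^ t) ^ 3 * 2 ^ t" by (intro mult_le_mono1) simp
  finally have K: "2 * ?K * (8 * 2 ^ t) \<le> card (params t)" using card by simp
  have ne: "trade m t 0 p \<noteq> {}" for p by (cases p) auto
  have "(8 * 2 ^ t) ^ ?K \<le> card (indep (params t) conflict ?K)"
    using fin ne card_conflict K by (intro card_indep_ge) (auto simp: conflict_def)
  also have "\<dots> \<le> card {B. is_bbd {0..<m} {m..<2 * m} B}"
  proof (rule card_inj_on_le)
    show "inj_on switched (indep (params t) conflict ?K)"
      by (rule inj_on_subset[OF inj_on_switched]) (auto simp: indep_def)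
    show "switched ` indep (params t) conflict ?K \<subseteq> {B. is_bbd {0..<m} {m..<2 * m} B}"
      using is_bbd_switched by blast
    show "finite {B. is_bbd {0..<m} {m..<2 * m} B}"
      by (rule finite_subset[of _ "Pow (Pow ({0..<m} \<union> {m..<2 * m}))"]) (auto simp: is_bbd_def)
  qed
  finally show ?thesis .
qed

end

section \<open>The number of designs\<close>

lemma bbd3_of_is_bbd:
  assumes "is_bbd g1 g2 B" "g1 \<inter> g2 = {}" "card g1 = card g2"
  shows "bbd3 (g1 \<union> g2) {g1, g2} B"
  unfolding bbd3_def
  by (rule exI[of _ g1], rule exI[of _ g2])
     (use assms in \<open>simp only: is_bbd_def simp_thms\<close>)

lemma is_bbd_of_bbd3:
  assumes "bbd3 X P B"
  shows "\<exists>g1 g2. P = {g1, g2} \<and> g1 \<inter> g2 = {} \<and> g1 \<union> g2 = X \<and> is_bbd g1 g2 B"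
proof -
  from assms obtain g1 g2 where "P = {g1, g2} \<and> g1 \<inter> g2 = {} \<and> g1 \<union> g2 = X \<and> card g1 = card g2 \<and>
        (\<forall>b\<in>B. b \<subseteq> X \<and> card b = 4 \<and> card (b \<inter> g1) = 2 \<and> card (b \<inter> g2) = 2) \<and>
        (\<forall>s. s \<subseteq> X \<and> card s = 3 \<and> s \<inter> g1 \<noteq> {} \<and> s \<inter> g2 \<noteq> {} \<longrightarrow> (\<exists>!b. b \<in> B \<and> s \<subseteq> b))"
    unfolding bbd3_def by (elim exE)
  then show ?thesis by (intro exI[of _ g1] exI[of _ g2]) (simp add: is_bbd_def)
qed

text \<open>Three points of a block always meet both halves, as each half contains only two of its
  points. Hence they determine the block, and any fourth point chosen by \<open>h\<close> is the
  right one.\<close>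

lemma bbd3_encoding:
  fixes X :: "'a set"
  assumes X: "finite X" and B: "bbd3 X P B"
  shows "\<exists>g\<in>Pow X. \<exists>h\<in>X \<times> X \<times> X \<rightarrow>\<^sub>E X. P = {g, X - g} \<and>
    B = {b. \<exists>x\<in>X. \<exists>y\<in>X. \<exists>z\<in>X. b = {x, y, z, h (x, y, z)} \<and> card b = 4}"
proof -
  obtain g1 g2 where P: "P = {g1, g2}" and dis: "g1 \<inter> g2 = {}" and un: "g1 \<union> g2 = X"
    and G: "is_bbd g1 g2 B"
    using is_bbd_of_bbd3[OF B] by blast
  have blk: "b \<subseteq> X \<and> card b = 4 \<and> card (b \<inter> g1) = 2 \<and> card (b \<inter> g2) = 2" if "b \<in> B" for b
    using G that un by (simp add: is_bbd_def)
  have ex1: "\<exists>!b. b \<in> B \<and> s \<subseteq> b" if "s \<subseteq> X" "card s = 3" "s \<inter> g1 \<noteq> {}" "s \<inter> g2 \<noteq> {}" for s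
    using G that un by (simp add: is_bbd_def)
  have uniq: "b = b'" if "b \<in> B" "b' \<in> B" "s \<subseteq> b" "s \<subseteq> b'" "card s = 3" for b b' s
  proof -
    have fin: "finite b" using blk[OF that(1)] by (metis card.infinite zero_neq_numeral)
    have "s \<inter> g \<noteq> {}" if "card (b \<inter> g) = 2" "g \<subseteq> X" for g
    proof
      assume "s \<inter> g = {}"
      then have "s \<subseteq> b - (b \<inter> g)" using \<open>s \<subseteq> b\<close> by blast
      then have "card s \<le> card (b - (b \<inter> g))" using fin by (intro card_mono) auto
      also have "\<dots> = 2" using blk[OF \<open>b \<in> B\<close>] that fin by (subst card_Diff_subset) auto
      finally show False using \<open>card s = 3\<close> by simp
    qed
    then have "s \<inter> g1 \<noteq> {}" "s \<inter> g2 \<noteq> {}" using blk[OF that(1)] un by auto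
    then have "\<exists>!b. b \<in> B \<and> s \<subseteq> b" using ex1[of s] that blk[OF that(1)] by blast
    then show ?thesis using that by blast
  qed
  define Q where "Q = (\<lambda>(x, y, z) w. {x, y, z, w} \<in> B \<and> card {x, y, z, w} = 4)"
  \<comment> \<open>The default \<open>fst v\<close> makes \<open>{x, y, z, h (x, y, z)}\<close> too small to be mistaken for a block.\<close>
  define h where "h = (\<lambda>v\<in>X \<times> X \<times> X. if \<exists>w. Q v w then SOME w. Q v w else fst v)"
  have h_eq: "h v = (if \<exists>w. Q v w then SOME w. Q v w else fst v)" if "v \<in> X \<times> X \<times> X" for v
    using that by (simp add: h_def)
  have QX: "w \<in> X" if "Q v w" for v w using that blk by (cases v) (auto simp: Q_def)
  have h: "h \<in> X \<times> X \<times> X \<rightarrow>\<^sub>E X"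
  proof (rule PiE_I)
    fix v assume v: "v \<in> X \<times> X \<times> X"
    show "h v \<in> X"
    proof (cases "\<exists>w. Q v w")
      case True
      then have "Q v (SOME w. Q v w)" by (rule someI_ex)
      then show ?thesis using v True QX by (simp add: h_def)
    next
      case False
      then show ?thesis using v by (auto simp: h_def)
    qed
  qed (simp add: h_def)
  have "B = {b. \<exists>x\<in>X. \<exists>y\<in>X. \<exists>z\<in>X. b = {x, y, z, h (x, y, z)} \<and> card b = 4}" (is "B = ?R")
  proof (intro equalityI subsetI)
    fix b assume b: "b \<in> B"
    then have bX: "b \<subseteq> X" and b4: "card b = 4" using blk by auto
    then obtain x y z w where bw: "b = {x, y, z, w}"
      by (auto simp: numeral_eq_Suc card_Suc_eq)
    have ne: "card {x, y, z} = 3" using b4 unfolding bw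
      by (auto simp: card_insert_if split: if_splits)
    have "Q (x, y, z) w" using b b4 bw by (simp add: Q_def)
    then have "Q (x, y, z) (SOME w. Q (x, y, z) w)" by (rule someI)
    moreover have hv: "h (x, y, z) = (SOME w. Q (x, y, z) w)"
      using \<open>Q (x, y, z) w\<close> bX bw by (auto simp: h_def)
    ultimately have "{x, y, z, h (x, y, z)} \<in> B" by (simp add: Q_def)
    then have "b = {x, y, z, h (x, y, z)}"
      by (intro uniq[OF b _ _ _ ne]) (auto simp: bw)
    then show "b \<in> ?R" using b4 bX bw by blast
  next
    fix b assume "b \<in> ?R"
    then obtain x y z where xyz: "x \<in> X" "y \<in> X" "z \<in> X" "b = {x, y, z, h (x, y, z)}" "card b = 4" by blast
    have "\<exists>w. Q (x, y, z) w"
    proof (rule ccontr)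
      assume "\<not> (\<exists>w. Q (x, y, z) w)"
      then have "h (x, y, z) = x" using xyz(1-3) h_eq[of "(x, y, z)"] by auto
      then show False using xyz(4,5) by (auto simp: card_insert_if split: if_splits)
    qed
    then have "Q (x, y, z) (h (x, y, z))"
      using xyz(1-3) h_eq[of "(x, y, z)"] someI_ex[of "Q (x, y, z)"] by auto
    then show "b \<in> B" using xyz by (simp add: Q_def)
  qed
  moreover have "P = {g1, X - g1}" "g1 \<in> Pow X" using P dis un by auto
  ultimately show ?thesis using h by blast
qed

text \<open>There are \<open>2 ^ n\<close> choices of a half and \<open>n ^ (n ^ 3)\<close> maps on
  triples. Finiteness is recorded too, since the comparison of cardinalities in \<open>D_ge\<close>
  relies on it.\<close>

lemma D_le:
  shows "finite {(P, B). bbd3 {0..<n} P B}" "D n \<le> 2 ^ n * n ^ (n ^ 3)"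
proof -
  let ?X = "{0..<n}" and ?D = "Pow {0..<n} \<times> ({0..<n} \<times> {0..<n} \<times> {0..<n} \<rightarrow>\<^sub>E {0..<n})"
  define f where "f = (\<lambda>(g, h). ({g, ?X - g}, {b. \<exists>x\<in>?X. \<exists>y\<in>?X. \<exists>z\<in>?X. b = {x, y, z, h (x, y, z)} \<and> card b = 4}))"
  have sub: "{(P, B). bbd3 ?X P B} \<subseteq> f ` ?D"
  proof clarify
    fix P B assume "bbd3 ?X P B"
    from bbd3_encoding[OF _ this] obtain g h where "g \<in> Pow ?X" "h \<in> ?X \<times> ?X \<times> ?X \<rightarrow>\<^sub>E ?X"
      "P = {g, ?X - g}" "B = {b. \<exists>x\<in>?X. \<exists>y\<in>?X. \<exists>z\<in>?X. b = {x, y, z, h (x, y, z)} \<and> card b = 4}" by auto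
    then show "(P, B) \<in> f ` ?D" by (intro image_eqI[of _ _ "(g, h)"]) (simp_all add: f_def)
  qed
  have fin: "finite ?D" by (intro finite_cartesian_product finite_PiE) auto
  then show "finite {(P, B). bbd3 ?X P B}" using sub finite_subset by blast
  have "D n \<le> card ?D" unfolding D_def using fin sub by (rule surj_card_le)
  also have "\<dots> = 2 ^ n * n ^ (n ^ 3)"
    by (simp add: card_cartesian_product card_Pow card_PiE power3_eq_cube mult.assoc)
  finally show "D n \<le> 2 ^ n * n ^ (n ^ 3)" .
qed

lemma D_ge:
  "card {B. is_bbd {0..<m} {m..<2 * m} B} \<le> D (2 * m)"
  unfolding D_def
proof (rule card_inj_on_le)
  show "inj_on (\<lambda>B. ({{0..<m}, {m..<2 * m}}, B)) {B. is_bbd {0..<m} {m..<2 * m} B}"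
    by (rule inj_onI) simp
  have "{0..<m} \<union> {m..<2 * m} = {0..<2 * m}" by auto
  then show "(\<lambda>B. ({{0..<m}, {m..<2 * m}}, B)) ` {B. is_bbd {0..<m} {m..<2 * m} B}
    \<subseteq> {(P, B). bbd3 {0..<2 * m} P B}"
    using bbd3_of_is_bbd[of "{0..<m}" "{m..<2 * m}"] by auto
qed (rule D_le)

section \<open>Asymptotic bounds\<close>

lemma D_lower_bound:
  assumes n: "n \<ge> 192" "4 dvd n"
  shows "real n ^ 3 * ln (real n) / 3538944 \<le> ln (real (D n))" "D n > 0"
proof -
  obtain k where k: "n = 4 * k" using n(2) by (elim dvdE)
  define m where "m = 2 * k"
  have nm: "n = 2 * m" and m: "even m" "m \<ge> 96" using n k by (simp_all add: m_def)
  \<comment> \<open>The factor 12 makes \<open>3 * 2 ^ (t + 2) \<le> m\<close>, the room required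
    for the one-factorization; maximality of \<open>t\<close> keeps \<open>2 ^ t\<close>
    proportional to \<open>m\<close>.\<close>
  obtain t where "2 ^ t \<le> m div 12" "m div 12 < 2 ^ (t + 1)"
    using ex_power_ivl1[of 2 "m div 12"] m div_le_mono[of 96 m 12] by auto
  then have t12: "12 * 2 ^ t \<le> m" and t24: "m < 24 * 2 ^ t" by auto
  define u :: nat where "u = 2 ^ t"
  have "(2::nat) ^ 2 < 2 ^ t" using t24 m by simp
  then have t: "t \<ge> 2" using power_less_imp_less_exp[of "2::nat" 2 t] by simp
  then obtain j where "t = 2 + j" using le_Suc_ex by blast
  then have "u = 4 * 2 ^ j" by (simp add: u_def power_add)
  \<comment> \<open>Since 4 divides \<open>u\<close>, the division by 16 is exact.\<close>
  then have K: "real (u ^ 3 div 16) = real u ^ 3 / 16" by (simp add: power_mult_distrib)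
  obtain C :: "(nat + int) set" and col where F: "one_factorization {0..<m} C col"
    and col: "\<forall>x<2 ^ (t + 2). \<forall>y<2 ^ (t + 2). col x y = Inl (x XOR y)"
    using xor_one_factorization_exists[of "t + 2" m] m t12 by auto
  have "xor_one_factorization m t C col"
    using F col t12 by unfold_locales auto
  then have "(8 * u) ^ (u ^ 3 div 16) \<le> D (2 * m)"
    unfolding u_def using xor_one_factorization.many_designs[OF _ t] D_ge order_trans by blast
  then have low: "(8 * u) ^ (u ^ 3 div 16) \<le> D n" by (simp add: nm)
  have u0: "u > 0" by (simp add: u_def)
  then have "(8 * u) ^ (u ^ 3 div 16) > 0" by simp
  with low show D0: "D n > 0" by linarith
  have "n \<le> 48 * u" using t24 by (simp add: u_def nm)
  then have "real n \<le> real (48 * u)" by (simp only: of_nat_le_iff)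
  then have un: "real n / 48 \<le> real u" by simp
  \<comment> \<open>From \<open>n \<ge> 36\<close>: thus \<open>8 * u\<close> is at least n/6, hence
    at least the square root of \<open>n\<close>, which costs a factor 2 in the logarithm.\<close>
  have "real n \<le> (real n / 6) ^ 2" using n by (simp add: power2_eq_square)
  also have "\<dots> \<le> (8 * real u) ^ 2" using un by (intro power_mono) auto
  finally have "ln (real n) \<le> ln ((8 * real u) ^ 2)" using n by (intro ln_mono) auto
  also have "\<dots> = 2 * ln (8 * real u)" using u0 by (subst ln_realpow) auto
  finally have ln: "ln (real n) / 2 \<le> ln (8 * real u)" by simp
  \<comment> \<open>The constant is 48^3 * 16 * 2: from n/48 \<le> u, the exponent u^3/16 and the
    halved logarithm.\<close>
  have "real n ^ 3 * ln (real n) / 3538944 = (real n / 48) ^ 3 / 16 * (ln (real n) / 2)"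
    by (simp add: power_divide)
  also have "\<dots> \<le> real u ^ 3 / 16 * ln (8 * real u)"
    using n un ln by (intro mult_mono divide_right_mono power_mono) auto
  also have "\<dots> = ln ((8 * real u) ^ (u ^ 3 div 16))"
    using u0 by (subst ln_realpow) (simp_all add: K)
  also have "\<dots> = ln (real ((8 * u) ^ (u ^ 3 div 16)))" by simp
  also have "\<dots> \<le> ln (real (D n))"
  proof -
    have le: "real ((8 * u) ^ (u ^ 3 div 16)) \<le> real (D n)" using low by (simp only: of_nat_le_iff)
    have "0 < real ((8 * u) ^ (u ^ 3 div 16))" using u0 by simp
    with le show ?thesis by (blast intro: ln_mono)
  qed
  finally show "real n ^ 3 * ln (real n) / 3538944 \<le> ln (real (D n))" .
qed

text \<open>The choice of the half costs at most \<open>2 ^ n \<le> n ^ (n ^ 3)\<close>, which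
  doubles the exponent and gives the constant 2. Positivity of \<open>D n\<close> permits
  monotonicity of \<open>ln\<close>.\<close>

lemma D_upper_bound:
  assumes n: "n \<ge> 2" and D0: "D n > 0"
  shows "ln (real (D n)) \<le> 2 * (real n ^ 3 * ln (real n))"
proof -
  have "D n \<le> 2 ^ n * n ^ (n ^ 3)" by (rule D_le)
  also have "\<dots> \<le> n ^ n * n ^ (n ^ 3)" using n by (intro mult_le_mono1 power_mono) auto
  also have "\<dots> \<le> n ^ (n ^ 3) * n ^ (n ^ 3)"
    using n by (intro mult_le_mono1 power_increasing) (auto simp: self_le_power)
  also have "\<dots> = n ^ (2 * n ^ 3)" by (simp add: mult_2 power_add)
  finally have "real (D n) \<le> real (n ^ (2 * n ^ 3))" by (simp only: of_nat_le_iff)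
  then have "ln (real (D n)) \<le> ln (real (n ^ (2 * n ^ 3)))"
    using D0 by (intro ln_mono) auto
  also have "\<dots> = ln (real n ^ (2 * n ^ 3))" by simp
  also have "\<dots> = real (2 * n ^ 3) * ln (real n)" using n by (simp only: ln_realpow of_nat_0_less_iff)
  finally show ?thesis by simp
qed

text \<open>Two fixed points of one half lie in blocks whose other points partition the other half
  into pairs, so n/2 must be even. For \<open>n \<ge> 6\<close> congruent to 2 modulo 4 there is
  thus no design, and the asymptotics concern multiples of 4.\<close>

theorem theorem2:
  shows "\<exists>c1 c2 :: real. 0 < c1 \<and> c1 \<le> c2 \<and> (\<exists>N::nat. \<forall>n\<ge>N. 4 dvd n \<longrightarrow>
           c1 * (real n ^ 3 * ln (real n)) \<le> ln (real (D n)) \<and>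
           ln (real (D n)) \<le> c2 * (real n ^ 3 * ln (real n)))"
proof (intro exI conjI)
  show "0 < (1 / 3538944 :: real)" "1 / 3538944 \<le> (2 :: real)" by simp_all
  show "\<forall>n\<ge>192. 4 dvd n \<longrightarrow> 1 / 3538944 * (real n ^ 3 * ln (real n)) \<le> ln (real (D n)) \<and>
           ln (real (D n)) \<le> 2 * (real n ^ 3 * ln (real n))"
    using D_lower_bound D_upper_bound by auto
qed

end
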